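(* Let $n\geq 2$ and let $K\subset\mathbb{C}^n$ be a convex body. Then $K$ is a (complex) ellipsoid if and only if any two non-trivial line sections of $K$ are affinely equivalent, i.e. whenever $L_1,L_2$ are complex affine lines such that $L_1\cap K$ and $L_2\cap K$ each contain more than one point, there is a complex affine bijection $\phi:L_1\to L_2$ with $\phi(L_1\cap K)=L_2\cap K$.
   Context: A convex body is a compact convex subset of $\mathbb{C}^n$ with nonempty interior. A (complex) ellipsoid in $\mathbb{C}^n$ is the image of the closed Euclidean unit ball under an invertible complex affine map. A line section of $K$ is $L\cap K$ for a complex affine line $L$; it is non-trivial if it is neither empty nor a single point. *)

theory Defs
  imports "HOL-Analysis.Analysis"
begin

text \<open>Points of C^n are vectors of type complex ^ 'n; complex scalar multiplication is *s.
  The norm on complex ^ 'n is the Euclidean (Hermitian) norm.\<close>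

definition convex_body :: "(complex ^ 'n) set \<Rightarrow> bool" where
  "convex_body K \<longleftrightarrow> compact K \<and> convex K \<and> interior K \<noteq> {}"

definition complex_ellipsoid :: "(complex ^ 'n) set \<Rightarrow> bool" where
  "complex_ellipsoid E \<longleftrightarrow>
     (\<exists>(A :: complex ^ 'n ^ 'n) b. invertible A \<and> E = (\<lambda>x. A *v x + b) ` cball 0 1)"

definition complex_affine_line :: "(complex ^ 'n) set \<Rightarrow> bool" where
  "complex_affine_line L \<longleftrightarrow>
     (\<exists>p v. v \<noteq> 0 \<and> L = {p + t *s v | t :: complex. True})"

definition complex_affine_on :: "(complex ^ 'n) set \<Rightarrow> (complex ^ 'n \<Rightarrow> complex ^ 'n) \<Rightarrow> bool" where
  "complex_affine_on S f \<longleftrightarrow>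
     (\<forall>x\<in>S. \<forall>y\<in>S. \<forall>t :: complex.
        f ((1 - t) *s x + t *s y) = (1 - t) *s f x + t *s f y)"

definition nontrivial_section :: "(complex ^ 'n) set \<Rightarrow> (complex ^ 'n) set \<Rightarrow> bool" where
  "nontrivial_section K L \<longleftrightarrow> (\<exists>x\<in>L \<inter> K. \<exists>y\<in>L \<inter> K. x \<noteq> y)"

end

theory Submission
  imports Defs
begin

text \<open>
  Suppose that all nontrivial line sections are similar to one plane convex body \<open>S\<close>. The sections through
  an interior point show that \<open>S\<close> is a disc: if \<open>S\<close> had only finitely many rotational symmetries, its position
  in the section would, after taking a power, trivialise a nonzero power of the Hopf bundle.

  If all line sections are discs, send a point \<open>p\<close> of \<open>K\<close> farthest from some origin to infinity by a complex
  projective map. The lines through \<open>p\<close> become vertical and \<open>K\<close> becomes \<open>{(v, w). \<phi> v \<le> Re w}\<close>, where every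
  sublevel set of \<open>\<phi>\<close> minus a real affine function is a disc on each complex line. Hence \<open>\<phi>\<close> is affine
  on every circle of such a line, which forces \<open>\<phi> s = A \<bar>s\<bar>\<^sup>2 + Re (\<alpha> s) + \<beta>\<close> on it. So \<open>\<phi>\<close> is a Hermitian
  quadratic polynomial, and \<open>K\<close> is an ellipsoid.
\<close>

section \<open>Functions whose affine sublevel sets are discs\<close>

text \<open>The farthest point makes the projective chart usable: \<open>K\<close> lies in a ball
  having \<open>p\<close> on its boundary, so the complex hyperplane tangent to that ball meets
  \<open>K\<close> only at \<open>p\<close> and can be sent to infinity. A separation argument,
  combined with the uniqueness of tangents to discs, shows that every complex line through
  \<open>p\<close> outside this hyperplane meets \<open>K\<close> in a disc of positive radius;
  hence \<phi> is finite everywhere. Such a disc is tangent to the hyperplane at \<open>p\<close>,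
  and inversion turns it into a half-plane. The coefficients \<open>A\<close>, \<alpha>, \<beta> are
  known only line by line. They are glued into one polynomial by writing the same points on lines
  whose base point and direction are exchanged. In the topological step, a power is taken because
  the rotation carrying \<open>S\<close> onto a section is determined only up to the symmetries of
  \<open>S\<close>. A second complex dimension supplies a disc of nonzero directions bounded by a
  circle orbit.\<close>

lemma three_points_affine_interpolation:
  fixes c :: complex and r u v w :: real
  assumes "r \<noteq> 0"
  shows "\<exists>\<alpha> \<beta>. Re (\<alpha> * (c + r)) + \<beta> = u \<and> Re (\<alpha> * (c - r)) + \<beta> = v
    \<and> Re (\<alpha> * (c + \<i> * r)) + \<beta> = w"
proof -
  define \<alpha> where "\<alpha> = Complex ((u - v) / (2 * r)) (((u + v) / 2 - w) / r)"
  define \<beta> where "\<beta> = (u + v) / 2 - Re (\<alpha> * c)"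
  have a: "Re \<alpha> * r = (u - v) / 2" "Im \<alpha> * r = (u + v) / 2 - w"
    using assms by (simp_all add: \<alpha>_def)
  show ?thesis
    by (rule exI[of _ \<alpha>], rule exI[of _ \<beta>]) (use a in \<open>simp add: \<beta>_def field_simps\<close>)
qed

lemma two_points_affine_interpolation:
  fixes x y :: complex
  assumes "x \<noteq> y"
  shows "\<exists>\<alpha> \<beta>. Re (\<alpha> * x) + \<beta> = u \<and> Re (\<alpha> * y) + \<beta> = (v::real)"
proof -
  define \<alpha> where "\<alpha> = of_real (v - u) / (y - x)"
  have "\<alpha> * (y - x) = of_real (v - u)" using assms by (simp add: \<alpha>_def)
  then have "Re (\<alpha> * y) - Re (\<alpha> * x) = v - u"
    by (metis Re_complex_of_real minus_complex.simps(1) right_diff_distrib)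
  then show ?thesis by (intro exI[of _ \<alpha>] exI[of _ "u - Re (\<alpha> * x)"]) auto
qed

locale disc_sublevels =
  fixes g :: "complex \<Rightarrow> real"
  assumes disc: "\<And>\<alpha> \<beta>. \<exists>c r. {s. g s \<le> Re (\<alpha> * s) + \<beta>} = cball c r"
begin

text \<open>The real affine function that interpolates \<open>g\<close> at \<open>x\<close> and
  \<open>y\<close> has a sublevel set containing both points; this set is a disc, hence contains the
  segment between them.\<close>

lemma convex_ineq:
  assumes u: "0 \<le> u" "u \<le> 1"
  shows "g ((1 - u) *\<^sub>R x + u *\<^sub>R y) \<le> (1 - u) * g x + u * g y"
proof (cases "x = y")
  case True
  then show ?thesis by (simp add: algebra_simps flip: scaleR_left_distrib)
next
  case False
  then obtain \<alpha> \<beta> where ab: "Re (\<alpha> * x) + \<beta> = g x" "Re (\<alpha> * y) + \<beta> = g y"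
    using two_points_affine_interpolation by blast
  obtain c r where D: "{s. g s \<le> Re (\<alpha> * s) + \<beta>} = cball c r" using disc by blast
  have "x \<in> cball c r" "y \<in> cball c r" using ab by (auto simp flip: D)
  then have "(1 - u) *\<^sub>R x + u *\<^sub>R y \<in> cball c r"
    using u convexD_alt[OF convex_cball] by blast
  then have "g ((1 - u) *\<^sub>R x + u *\<^sub>R y) \<le> Re (\<alpha> * ((1 - u) *\<^sub>R x + u *\<^sub>R y)) + \<beta>"
    by (simp flip: D)
  also have "\<dots> = (1 - u) * (Re (\<alpha> * x) + \<beta>) + u * (Re (\<alpha> * y) + \<beta>)"
    by (simp add: algebra_simps)
  finally show ?thesis by (simp only: ab)
qed

text \<open>Strict inequality at a boundary point would leave slack, and convexity along the ray
  from \<open>c\<close> through \<open>s\<close> would carry the inequality a little beyond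
  \<open>s\<close>, outside the disc.\<close>

lemma eq_on_boundary:
  assumes D: "{s. g s \<le> Re (\<alpha> * s) + \<beta>} = cball c r" and s: "s \<in> sphere c r" and "r > 0"
  shows "g s = Re (\<alpha> * s) + \<beta>"
proof (rule ccontr)
  define l where "l x = Re (\<alpha> * x) + \<beta>" for x
  assume "g s \<noteq> Re (\<alpha> * s) + \<beta>"
  moreover have "s \<in> cball c r" using s by auto
  ultimately have "g s < l s" unfolding l_def by (simp flip: D)
  define p where "p = s + (s - c)"
  define e where "e = l s - g s"
  define M where "M = \<bar>g p - l p\<bar>"
  \<comment> \<open>Chosen so that the slack \<open>(1 - u) * e\<close> kept from \<open>s\<close>
    exactly pays for the worst possible excess \<open>u * M\<close> at \<open>p\<close>.\<close>
  define u where "u = e / (e + M)"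
  have e: "e > 0" and M: "M \<ge> 0" using \<open>g s < l s\<close> by (auto simp: e_def M_def)
  then have u: "0 < u" "u \<le> 1" and uM: "u * M = (1 - u) * e"
    by (auto simp: u_def field_simps)
  have "g ((1 - u) *\<^sub>R s + u *\<^sub>R p) \<le> (1 - u) * g s + u * g p"
    using u convex_ineq by auto
  also have "\<dots> \<le> (1 - u) * g s + u * (l p + M)"
    using u by (intro add_left_mono mult_left_mono) (auto simp: M_def)
  also have "\<dots> = (1 - u) * l s + u * l p"
    using uM by (simp add: e_def algebra_simps)
  also have "\<dots> = l ((1 - u) *\<^sub>R s + u *\<^sub>R p)" by (simp add: l_def algebra_simps)
  finally have "(1 - u) *\<^sub>R s + u *\<^sub>R p \<in> cball c r" by (simp add: l_def flip: D)
  moreover have "(1 - u) *\<^sub>R s + u *\<^sub>R p - c = (1 + u) *\<^sub>R (s - c)"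
    by (simp add: p_def algebra_simps scaleR_left_distrib)
  ultimately have "(1 + u) * norm (s - c) \<le> r"
    by (metis abs_of_nonneg add_nonneg_nonneg dist_commute dist_norm less_imp_le mem_cball
        norm_scaleR u(1) zero_le_one)
  moreover have "norm (s - c) = r" using s by (simp add: dist_norm norm_minus_commute)
  ultimately show False using mult_pos_pos[OF \<open>r > 0\<close> u(1)] by (simp add: algebra_simps)
qed

text \<open>If equality held at an interior point, it would hold near that point by convexity; tilting the
  affine function about it would then give a disc bounded by a line segment.\<close>

lemma strict_in_interior:
  assumes D: "{s. g s \<le> Re (\<alpha> * s) + \<beta>} = cball c r" and s: "s \<in> ball c r"
  shows "g s < Re (\<alpha> * s) + \<beta>"
proof (rule ccontr)
  define l where "l x = Re (\<alpha> * x) + \<beta>" for x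
  have lD: "g x \<le> l x \<longleftrightarrow> x \<in> cball c r" for x unfolding l_def using D by blast
  assume "\<not> g s < Re (\<alpha> * s) + \<beta>"
  moreover have "g s \<le> l s" using s lD by auto
  ultimately have gs: "g s = l s" unfolding l_def by simp
  obtain \<rho> where \<rho>: "\<rho> > 0" "cball s \<rho> \<subseteq> cball c r"
    using s by (metis ball_subset_cball open_ball open_contains_cball_eq order_trans)
  have near: "g (s + e) = l (s + e)" if "norm e \<le> \<rho>" for e
  proof -
    have "s + e \<in> cball s \<rho>" "s - e \<in> cball s \<rho>" using that by (auto simp: dist_norm)
    then have 1: "g (s + e) \<le> l (s + e)" "g (s - e) \<le> l (s - e)" using lD \<rho> by blast+
    have "(1 - 1/2) *\<^sub>R (s + e) + (1/2) *\<^sub>R (s - e) = s"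
      by (simp add: algebra_simps flip: scaleR_left_distrib)
    then have "g s \<le> g (s + e) / 2 + g (s - e) / 2"
      using convex_ineq[of "1/2" "s + e" "s - e"] by simp
    moreover have "l s = l (s + e) / 2 + l (s - e) / 2" by (simp add: l_def field_simps)
    ultimately show ?thesis using 1 gs by linarith
  qed
  define l' where "l' x = Re ((\<alpha> + 1) * x) + (\<beta> - Re s)" for x
  have l': "l' x = l x + Re (x - s)" for x by (simp add: l'_def l_def algebra_simps)
  obtain c' r' where "{x. g x \<le> Re ((\<alpha> + 1) * x) + (\<beta> - Re s)} = cball c' r'"
    using disc[of "\<alpha> + 1" "\<beta> - Re s"] by blast
  then have D': "g x \<le> l' x \<longleftrightarrow> x \<in> cball c' r'" for x
    unfolding l'_def by blast
  \<comment> \<open>The tilt \<open>Re (x - s)\<close> vanishes at these two points, so both lie in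
    the tilted disc; the parallelogram identity then puts their midpoint \<open>s\<close> strictly
    inside it.\<close>
  have "s + \<i> * \<rho> \<in> cball c' r'" "s - \<i> * \<rho> \<in> cball c' r'"
    unfolding D'[symmetric]
    using near[of "\<i> * \<rho>"] near[of "- (\<i> * \<rho>)"] \<rho>(1) by (auto simp: l' norm_mult)
  then have n1: "norm (s - c' + \<i> * \<rho>) \<le> r'" and n2: "norm (s - c' - \<i> * \<rho>) \<le> r'"
    by (auto simp: dist_norm algebra_simps norm_minus_commute)
  have "(norm (s - c' + \<i> * \<rho>))\<^sup>2 + (norm (s - c' - \<i> * \<rho>))\<^sup>2 = 2 * (norm (s - c'))\<^sup>2 + 2 * \<rho>\<^sup>2"
    unfolding cmod_power2 by (simp add: power2_eq_square algebra_simps)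
  moreover have "(norm (s - c' + \<i> * \<rho>))\<^sup>2 \<le> r'\<^sup>2" "(norm (s - c' - \<i> * \<rho>))\<^sup>2 \<le> r'\<^sup>2"
    using n1 n2 by (simp_all add: power_mono)
  ultimately have "(norm (s - c'))\<^sup>2 < r'\<^sup>2" using \<rho>(1) by (smt (verit) zero_less_power2)
  then have lt: "norm (s - c') < r'"
    using n1 norm_ge_zero by (smt (verit) power_less_imp_less_base)
  \<comment> \<open>Moving from \<open>s\<close> against the tilt by \<epsilon> stays in the tilted
    disc and in the region where \<open>g = l\<close>, although \<open>l'\<close> is smaller than
    \<open>l\<close> there.\<close>
  define \<epsilon> where "\<epsilon> = min \<rho> (r' - norm (s - c'))"
  have e: "\<epsilon> > 0" "\<epsilon> \<le> \<rho>" "norm (s - c') + \<epsilon> \<le> r'" using lt \<rho>(1) by (auto simp: \<epsilon>_def)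
  have "norm (s - c' - \<epsilon>) \<le> norm (s - c') + \<epsilon>"
    using norm_triangle_ineq4[of "s - c'" "of_real \<epsilon>"] e(1) by simp
  then have "s + - of_real \<epsilon> \<in> cball c' r'"
    using e(3) by (simp add: dist_norm norm_minus_commute algebra_simps)
  then have "g (s + - of_real \<epsilon>) \<le> l' (s + - of_real \<epsilon>)" using D' by blast
  moreover have "g (s + - of_real \<epsilon>) = l (s + - of_real \<epsilon>)"
    using e by (intro near) simp
  ultimately show False using e(1) by (simp add: l')
qed

text \<open>Interpolate \<open>g\<close> at three points of the circle. Equality is impossible
  inside the resulting sublevel disc, so the three points lie on its boundary; a circle is
  determined by three points, so that boundary is the given circle.\<close>

lemma affine_on_circle:
  assumes "r > 0"
  shows "\<exists>\<alpha> \<beta>. \<forall>s\<in>sphere c r. g s = Re (\<alpha> * s) + \<beta>"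
proof -
  obtain \<alpha> \<beta> where ab: "Re (\<alpha> * (c + r)) + \<beta> = g (c + r)"
      "Re (\<alpha> * (c - r)) + \<beta> = g (c - r)" "Re (\<alpha> * (c + \<i> * r)) + \<beta> = g (c + \<i> * r)"
    using three_points_affine_interpolation assms by (metis less_irrefl)
  obtain c' r' where D: "{s. g s \<le> Re (\<alpha> * s) + \<beta>} = cball c' r'" using disc by blast
  have *: "norm (s - c') = r'" if "Re (\<alpha> * s) + \<beta> = g s" for s
  proof -
    have "s \<in> cball c' r'" using that by (simp flip: D)
    moreover have "s \<notin> ball c' r'" using strict_in_interior[OF D] that by force
    ultimately show ?thesis by (simp add: dist_norm norm_minus_commute)
  qed
  define d where "d = c - c'"
  have n: "norm (d + r) = r'" "norm (d - r) = r'" "norm (d + \<i> * r) = r'"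
    using *[OF ab(1)] *[OF ab(2)] *[OF ab(3)] by (simp_all add: d_def algebra_simps)
  then have "(norm (d + r))\<^sup>2 = (norm (d - r))\<^sup>2" "(norm (d + r))\<^sup>2 = (norm (d + \<i> * r))\<^sup>2" by simp_all
  then have "Re d * r = 0" "Re d * r = Im d * r"
    unfolding cmod_power2 by (simp_all add: power2_eq_square algebra_simps)
  then have "d = 0" using assms by (simp add: complex_eq_iff)
  then have "c' = c" "r' = r" using n(1) assms by (auto simp: d_def)
  then show ?thesis using eq_on_boundary[OF D] assms by blast
qed

text \<open>After subtracting a suitable quadratic, \<open>g\<close> vanishes on the unit circle and at \<open>0\<close>. Every other
  point lies on a circle through \<open>0\<close> that meets the unit circle twice, and a real affine function
  vanishing at three points of a circle vanishes on it.\<close>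

lemma quadratic:
  shows "\<exists>A \<alpha> \<beta>. A > 0 \<and> (\<forall>s. g s = A * (norm s)\<^sup>2 + Re (\<alpha> * s) + \<beta>)"
proof -
  obtain \<alpha> \<beta> where ab: "\<And>s. norm s = 1 \<Longrightarrow> g s = Re (\<alpha> * s) + \<beta>"
    using affine_on_circle[of 1 0] by auto
  define A where "A = \<beta> - g 0"
  have eq: "g y = A * (norm y)\<^sup>2 + Re (\<alpha> * y) + g 0" for y
  proof (cases "y = 0")
    case False
    \<comment> \<open>A point on the perpendicular bisector of \<open>0\<close> and
      \<open>y\<close>, at distance 1 from the midpoint: the circle about \<open>m\<close> through
      \<open>0\<close> also passes through \<open>y\<close>, and \<open>norm m \<ge> 1\<close> makes
      it cross the unit circle twice.\<close>
    define m where "m = y / 2 + \<i> * y / norm y"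
    have "m = y * Complex (1/2) (1 / norm y)" by (simp add: m_def complex_eq_iff algebra_simps)
    then have "(norm m)\<^sup>2 = (norm y)\<^sup>2 * (1/4 + (1 / norm y)\<^sup>2)"
      by (simp only: norm_mult power_mult_distrib cmod_power2[of "Complex _ _"] complex.sel)
        (simp add: power2_eq_square)
    also have "\<dots> = (norm y)\<^sup>2 / 4 + 1" using False by (simp add: field_simps)
    finally have m2: "(norm m)\<^sup>2 \<ge> 1" by simp
    then have m1: "norm m \<ge> 1" using power2_le_imp_le[of 1 "norm m"] by simp
    then have m0: "norm m > 0" "m \<noteq> 0" by auto
    obtain \<gamma> \<delta> where gd: "\<And>s. norm (s - m) = norm m \<Longrightarrow> g s = Re (\<gamma> * s) + \<delta>"
    proof -
      obtain \<gamma> \<delta> where "\<forall>s\<in>sphere m (norm m). g s = Re (\<gamma> * s) + \<delta>"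
        using affine_on_circle m0(1) by blast
      then show thesis using that[of \<gamma> \<delta>] by (metis dist_commute dist_norm mem_sphere)
    qed
    have circ: "norm (s - m) = norm m \<longleftrightarrow> (norm s)\<^sup>2 = 2 * Re (s * cnj m)" for s
    proof -
      have "(norm (s - m))\<^sup>2 = (norm s)\<^sup>2 - 2 * Re (s * cnj m) + (norm m)\<^sup>2"
        unfolding cmod_power2 by (simp add: power2_eq_square algebra_simps)
      then show ?thesis
        by (smt (verit) norm_ge_zero power2_eq_imp_eq)
    qed
    have \<delta>: "\<delta> = g 0" using gd[of 0] by simp
    \<comment> \<open>On the circle about \<open>m\<close>, a point of norm 1 satisfies
      \<open>2 * Re (s * cnj m) = 1\<close>. In coordinates along \<open>u = m / norm m\<close>, the
      two crossings are therefore \<open>Complex \<kappa> \<mu>\<close> and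
      \<open>Complex \<kappa> (- \<mu>)\<close>.\<close>
    define \<kappa> where "\<kappa> = 1 / (2 * norm m)"
    have \<kappa>: "0 < \<kappa>" "\<kappa> \<le> 1/2" using m1 by (auto simp: \<kappa>_def divide_simps)
    define \<mu> where "\<mu> = sqrt (1 - \<kappa>\<^sup>2)"
    have "\<kappa>\<^sup>2 < 1" using \<kappa> by (simp add: power_less_one_iff abs_square_less_1)
    then have \<mu>: "\<mu> > 0" "\<kappa>\<^sup>2 + \<mu>\<^sup>2 = 1" by (auto simp: \<mu>_def)
    define u where "u = m / norm m"
    have u: "norm u = 1" "u * cnj m = norm m"
    proof -
      show "norm u = 1" using m0 by (simp add: u_def norm_divide)
      have "m * cnj m = (norm m)\<^sup>2" using complex_norm_square[of m] by simp
      then show "u * cnj m = norm m" by (simp add: u_def power2_eq_square)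
    qed
    have zero: "Re ((\<gamma> - \<alpha>) * (u * w)) = A" if "norm w = 1" "Re w = \<kappa>" for w
    proof -
      have 1: "norm (u * w) = 1" using u that by (simp add: norm_mult)
      have "u * w * cnj m = norm m * w" using u(2) by (metis mult.assoc mult.commute)
      then have "Re (u * w * cnj m) = norm m * \<kappa>" by (metis that(2) Re_complex_of_real Im_complex_of_real diff_zero mult_zero_left times_complex.sel(1))
      then have "2 * Re (u * w * cnj m) = 1" using m0 by (simp only: \<kappa>_def) simp
      then have "norm (u * w - m) = norm m" using circ 1 by simp
      then have "Re (\<gamma> * (u * w)) + \<delta> = Re (\<alpha> * (u * w)) + \<beta>" using gd ab[OF 1] by metis
      then show ?thesis by (simp add: A_def \<delta> algebra_simps)
    qed
    define \<eta> where "\<eta> = (\<gamma> - \<alpha>) * u"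
    have "Re (\<eta> * Complex \<kappa> \<mu>) = A" "Re (\<eta> * Complex \<kappa> (- \<mu>)) = A"
      using zero[of "Complex \<kappa> \<mu>"] zero[of "Complex \<kappa> (-\<mu>)"] \<mu>(2)
      by (simp_all add: \<eta>_def cmod_def mult.assoc)
    then have "Im \<eta> * \<mu> = 0" "Re \<eta> * \<kappa> = A" by (simp_all add: algebra_simps)
    then have \<eta>: "\<eta> = of_real (2 * A * norm m)"
      using \<mu> m0 by (auto simp: complex_eq_iff \<kappa>_def field_simps)
    have "u * cnj u = 1" using u(1) complex_norm_square[of u] by simp
    then have "\<gamma> - \<alpha> = \<eta> * cnj u" by (simp add: \<eta>_def mult.assoc)
    also have "\<dots> = 2 * A * cnj m" using m0 by (auto simp: \<eta> u_def)
    \<comment> \<open>This is the affine function expected from the quadratic, since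
      \<open>(norm s)\<^sup>2 = 2 * Re (s * cnj m)\<close> on this circle.\<close>
    finally have ga: "\<gamma> = \<alpha> + 2 * A * cnj m" by (simp add: algebra_simps)
    have y: "2 * Re (y * cnj m) = (norm y)\<^sup>2"
      unfolding cmod_power2 m_def by (simp add: power2_eq_square algebra_simps)
    then have "norm (y - m) = norm m" by (simp only: circ)
    then have "g y = Re (\<gamma> * y) + g 0" unfolding \<delta>[symmetric] by (rule gd)
    moreover have "Re (\<gamma> * y) = Re (\<alpha> * y) + A * (2 * Re (y * cnj m))"
      by (simp add: ga algebra_simps)
    ultimately show ?thesis unfolding y by linarith
  qed simp
  \<comment> \<open>Otherwise some affine function would dominate \<open>g\<close> everywhere,
    making a sublevel set the whole plane instead of a bounded disc.\<close>
  have "A > 0"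
  proof (rule ccontr)
    assume "\<not> A > 0"
    then have "A * (norm s)\<^sup>2 \<le> 0" for s :: complex by (simp add: mult_nonpos_nonneg)
    then have "g s \<le> Re (\<alpha> * s) + g 0" for s using eq[of s] by (metis add.assoc add_le_same_cancel2)
    then have "{s. g s \<le> Re (\<alpha> * s) + g 0} = UNIV" by blast
    then show False using disc[of \<alpha> "g 0"] by (metis bounded_cball not_bounded_UNIV)
  qed
  then show ?thesis using eq by blast
qed

end

section \<open>Hermitian quadratic forms\<close>

text \<open>These are the functions \<open>H x x\<close> for a Hermitian form \<open>H\<close>,
  described by their restrictions to complex lines because that is the form in which the data
  arrive; \<open>H\<close> itself is recovered below by polarisation.\<close>

definition hermitian_quadratic :: "(complex ^ 'n \<Rightarrow> real) \<Rightarrow> bool" where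
  "hermitian_quadratic q \<longleftrightarrow>
     (\<forall>s x. q (s *s x) = (norm s)\<^sup>2 * q x) \<and>
     (\<forall>y d. \<exists>\<gamma>. \<forall>s. q (y + s *s d) = q y + (norm s)\<^sup>2 * q d + Re (\<gamma> * s))"

lemma hermitian_quadratic_add:
  assumes "hermitian_quadratic p" "hermitian_quadratic q"
  shows "hermitian_quadratic (\<lambda>x. p x + q x)"
  unfolding hermitian_quadratic_def
proof (intro conjI allI)
  fix s x show "p (s *s x) + q (s *s x) = (norm s)\<^sup>2 * (p x + q x)"
    using assms by (simp add: hermitian_quadratic_def algebra_simps)
next
  fix y d
  obtain \<gamma> \<delta> where "\<And>s. p (y + s *s d) = p y + (norm s)\<^sup>2 * p d + Re (\<gamma> * s)"
    "\<And>s. q (y + s *s d) = q y + (norm s)\<^sup>2 * q d + Re (\<delta> * s)"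
    using assms unfolding hermitian_quadratic_def by metis
  then show "\<exists>\<gamma>. \<forall>s. p (y + s *s d) + q (y + s *s d) = p y + q y + (norm s)\<^sup>2 * (p d + q d) + Re (\<gamma> * s)"
    by (intro exI[of _ "\<gamma> + \<delta>"]) (simp add: distrib_left distrib_right)
qed

text \<open>Provides the cross term that arises when the affine part of a quadratic polynomial is
  homogenised by a linear form \<open>F\<close>.\<close>

lemma hermitian_quadratic_product:
  fixes F G :: "complex ^ 'n \<Rightarrow> complex"
  assumes F: "\<And>x y. F (x + y) = F x + F y" "\<And>s x. F (s *s x) = s * F x"
    and G: "\<And>x y. G (x + y) = G x + G y" "\<And>s x. G (s *s x) = s * G x"
  shows "hermitian_quadratic (\<lambda>x. Re (cnj (F x) * G x))"
  unfolding hermitian_quadratic_def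
proof (intro conjI allI)
  fix s x show "Re (cnj (F (s *s x)) * G (s *s x)) = (norm s)\<^sup>2 * Re (cnj (F x) * G x)"
    unfolding F G cmod_power2 by (simp add: power2_eq_square algebra_simps)
next
  fix y d
  show "\<exists>\<gamma>. \<forall>s. Re (cnj (F (y + s *s d)) * G (y + s *s d)) =
      Re (cnj (F y) * G y) + (norm s)\<^sup>2 * Re (cnj (F d) * G d) + Re (\<gamma> * s)"
    unfolding F G cmod_power2
    by (intro exI[of _ "cnj (F y) * G d + F d * cnj (G y)"])
      (simp add: power2_eq_square algebra_simps)
qed

locale hermitian_form =
  fixes q :: "complex ^ 'n \<Rightarrow> real"
  assumes herm: "hermitian_quadratic q"
begin

lemma scale: "q (s *s x) = (norm s)\<^sup>2 * q x"
  using herm by (simp add: hermitian_quadratic_def)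

lemma line: "\<exists>\<gamma>. \<forall>s. q (y + s *s d) = q y + (norm s)\<^sup>2 * q d + Re (\<gamma> * s)"
  using herm by (simp add: hermitian_quadratic_def)

lemma minus: "q (- x) = q x"
  using scale[of "-1" x] by simp

lemma parallelogram: "q (x + y) + q (x - y) = 2 * q x + 2 * q y"
proof -
  obtain \<gamma> where g: "\<And>s. q (x + s *s y) = q x + (norm s)\<^sup>2 * q y + Re (\<gamma> * s)"
    using line by blast
  show ?thesis using g[of 1] g[of "-1"] by simp
qed

definition B where "B x y = q (x + y) - q x - q y"

lemma B_commute: "B x y = B y x"
  by (simp add: B_def add.commute)

text \<open>The third difference of \<open>q\<close> is odd in each argument by the parallelogram law, and even in the
  triple because \<open>q\<close> is even, so it vanishes.\<close>

lemma B_add_right: "B x (y + z) = B x y + B x z"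
proof -
  define D where "D x y z = q (x + y + z) - q (x + y) - q (y + z) - q (x + z) + q x + q y + q z"
    for x y z
  have odd: "D x y (- z) = - D x y z" for x y z
    using parallelogram[of "x + y" z] parallelogram[of y z] parallelogram[of x z]
    by (simp add: D_def minus)
  have sym: "D x y z = D y z x" for x y z
    by (simp add: D_def algebra_simps)
  have "D (- x) (- y) (- z) = - D x y z"
    by (metis odd sym minus_minus)
  moreover have "D (- x) (- y) (- z) = D x y z"
    using minus[of "x + y + z"] minus[of "x + y"] minus[of "x + z"] minus[of "y + z"]
    by (simp add: D_def minus algebra_simps)
  ultimately have "D x y z = 0" by simp
  then show ?thesis by (simp add: D_def B_def algebra_simps)
qed

text \<open>The real part is half of the polar form; the imaginary part is forced by complex
  linearity in the first argument, \<open>Im (H x y) = - Re (H (\<i> *s x) y)\<close>.\<close>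

definition H where "H x y = Complex (B x y / 2) (- B y (\<i> *s x) / 2)"

text \<open>On one complex line \<open>B y (s *s x) = Re (\<gamma> * s)\<close> with a single
  \<gamma>, so all scalars are handled at once.\<close>

lemma H_scale_left: "H (s *s x) y = s * H x y"
proof -
  obtain \<gamma> where g: "\<And>s. q (y + s *s x) = q y + (norm s)\<^sup>2 * q x + Re (\<gamma> * s)"
    using line by blast
  have B: "B y (s *s x) = Re (\<gamma> * s)" for s by (simp add: B_def g scale)
  have "B (s *s x) y = Re (\<gamma> * s)" "B y (\<i> *s (s *s x)) = Re (\<gamma> * (\<i> * s))" for s
    using B[of s] B[of "\<i> * s"] B_commute by (auto simp: vector_smult_assoc)
  from this(1)[of s] this(2)[of s] this(1)[of 1] this(2)[of 1]
  show ?thesis by (simp add: H_def complex_eq_iff field_simps)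
qed

lemma H_add_left: "H (x + y) z = H x z + H y z"
  using B_add_right[of z x y] B_add_right[of z "\<i> *s x" "\<i> *s y"]
  by (simp add: H_def complex_eq_iff B_commute[of _ z] vector_add_ldistrib add_divide_distrib)

lemma B_rotate: "B (\<i> *s x) (\<i> *s y) = B x y"
  using scale[of \<i> "x + y"] scale[of \<i> x] scale[of \<i> y] by (simp add: B_def vector_add_ldistrib)

text \<open>Multiplying both arguments by \<open>\<i>\<close> preserves \<open>B\<close>, so
  \<open>\<i>\<close> passes from one argument to the other at the cost of a sign; this makes the
  imaginary part antisymmetric.\<close>

lemma H_cnj: "H y x = cnj (H x y)"
proof -
  have "B x (- y) = - B x y"
    using parallelogram[of x y] by (simp add: B_def minus)
  moreover have "B x (\<i> *s y) = B (\<i> *s x) (- y)"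
    using B_rotate[of x "\<i> *s y"] by (simp add: vector_smult_assoc)
  moreover have "B (\<i> *s x) (- y) = - B (\<i> *s x) y"
    using parallelogram[of "\<i> *s x" y] by (simp add: B_def minus)
  ultimately show ?thesis by (simp add: H_def complex_eq_iff B_commute)
qed

lemma H_zero_left: "H 0 y = 0"
  using H_scale_left[of 0 0 y] by simp

lemma H_sum_left: "H (\<Sum>i\<in>I. f i) y = (\<Sum>i\<in>I. H (f i) y)"
  by (induction I rule: infinite_finite_induct) (auto simp: H_add_left H_zero_left)

lemma H_diff_left: "H (x - y) z = H x z - H y z"
  using H_add_left[of "x - y" y z] by simp

lemma H_scale_right: "H x (s *s y) = cnj s * H x y"
  by (metis H_cnj H_scale_left complex_cnj_mult)

lemma H_sum_right: "H y (\<Sum>i\<in>I. f i) = (\<Sum>i\<in>I. H y (f i))"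
proof -
  have "H y (\<Sum>i\<in>I. f i) = cnj (H (\<Sum>i\<in>I. f i) y)" by (rule H_cnj)
  also have "\<dots> = (\<Sum>i\<in>I. cnj (H (f i) y))" by (simp add: H_sum_left)
  also have "\<dots> = (\<Sum>i\<in>I. H y (f i))" by (simp flip: H_cnj)
  finally show ?thesis .
qed

lemma H_self: "H x x = of_real (q x)"
proof -
  have "x + \<i> *s x = (1 + \<i>) *s x" "x + x = 2 *s x"
    by (simp_all add: vec_eq_iff algebra_simps)
  then have "q (x + \<i> *s x) = 2 * q x" "q (x + x) = 4 * q x" "q (\<i> *s x) = q x"
    by (simp_all only: scale) (simp_all add: cmod_power2)
  then show ?thesis by (simp add: H_def B_def complex_eq_iff)
qed

text \<open>Gram-Schmidt for \<open>H\<close>, by induction over sets of coordinate indices, so that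
  the final family can serve as the columns of a matrix. The next vector exists because fewer than
  \<open>CARD('n)\<close> vectors do not span.\<close>

lemma orthonormal_family:
  fixes J :: "'n set"
  assumes pos: "\<And>x. x \<noteq> 0 \<Longrightarrow> q x > 0"
  shows "\<exists>b. \<forall>i\<in>J. \<forall>j\<in>J. H (b i) (b j) = (if i = j then 1 else 0)"
proof -
  have "finite J" by simp
  then show ?thesis
  proof (induction J)
    case (insert k J)
    then obtain b where b: "\<And>i j. i \<in> J \<Longrightarrow> j \<in> J \<Longrightarrow> H (b i) (b j) = (if i = j then 1 else 0)"
      by blast
    have "J \<noteq> UNIV" using insert.hyps(2) by blast
    then have "card J < CARD('n)" by (simp add: psubset_card_mono psubset_eq)
    moreover have "card (b ` J) \<le> card J" by (simp add: card_image_le)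
    moreover have "vec.dim (b ` J) \<le> card (b ` J)" by (simp add: vec.dim_le_card')
    ultimately have "vec.dim (b ` J) < vec.dim (UNIV :: (complex ^ 'n) set)"
      unfolding vec_dim_card by linarith
    then have "vec.span (b ` J) \<noteq> UNIV" by (metis vec.dim_span less_irrefl)
    then obtain v where v: "v \<notin> vec.span (b ` J)" by blast
    define w where "w = (\<Sum>j\<in>J. H v (b j) *s b j)"
    define u where "u = v - w"
    have "w \<in> vec.span (b ` J)"
      unfolding w_def by (intro vec.span_sum vec.span_scale vec.span_base) auto
    then have "u \<noteq> 0" using v by (auto simp: u_def)
    then have qu: "q u > 0" by (rule pos)
    have orth: "H u (b j) = 0" if "j \<in> J" for j
    proof -
      have "H w (b j) = (\<Sum>i\<in>J. H v (b i) * (if i = j then 1 else 0))"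
        unfolding w_def H_sum_left H_scale_left by (intro sum.cong) (use b that in auto)
      also have "\<dots> = H v (b j)" using that by (simp add: if_distrib cong: if_cong)
      finally show ?thesis by (simp add: u_def H_diff_left)
    qed
    define e where "e = of_real (1 / sqrt (q u)) *s u"
    have e1: "H e e = 1"
    proof -
      have "q e = 1" using qu by (simp add: e_def scale norm_divide power_divide)
      then show ?thesis by (simp add: H_self)
    qed
    have e2: "H e (b j) = 0" "H (b j) e = 0" if "j \<in> J" for j
      using orth[OF that] H_cnj[of "b j" e] by (simp_all add: e_def H_scale_left)
    show ?case
    proof (intro exI[of _ "b(k := e)"] ballI)
      fix i j assume "i \<in> insert k J" "j \<in> insert k J"
      then show "H ((b(k := e)) i) ((b(k := e)) j) = (if i = j then 1 else 0)"
        using insert.hyps(2) b e1 e2 by auto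
    qed
  qed simp
qed

text \<open>The columns of \<open>A\<close> form an \<open>H\<close>-orthonormal family;
  invertibility follows because \<open>A\<close> carries the squared norm to \<open>q\<close> and
  thus has trivial kernel.\<close>

lemma diagonalise:
  assumes pos: "\<And>x. x \<noteq> 0 \<Longrightarrow> q x > 0"
  shows "\<exists>A :: complex ^ 'n ^ 'n. invertible A \<and> (\<forall>z. q (A *v z) = (norm z)\<^sup>2)"
proof -
  obtain b :: "'n \<Rightarrow> complex ^ 'n" where b: "\<And>i j. H (b i) (b j) = (if i = j then 1 else 0)"
    using orthonormal_family[OF pos, where J = UNIV] by auto
  define A :: "complex ^ 'n ^ 'n" where "A = (\<chi> i j. b j $ i)"
  have A: "A *v z = (\<Sum>j\<in>UNIV. z $ j *s b j)" for z
    by (simp add: vec_eq_iff A_def matrix_vector_mult_def mult.commute)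
  have q: "q (A *v z) = (norm z)\<^sup>2" for z
  proof -
    have "complex_of_real (q (A *v z)) = H (A *v z) (A *v z)" by (simp add: H_self)
    also have "\<dots> = (\<Sum>i\<in>UNIV. z $ i * (\<Sum>j\<in>UNIV. cnj (z $ j) * (if i = j then 1 else 0)))"
      unfolding A H_sum_left H_scale_left unfolding H_sum_right H_scale_right unfolding b ..
    also have "\<dots> = (\<Sum>i\<in>UNIV. of_real ((norm (z $ i))\<^sup>2))"
    proof (rule sum.cong)
      fix i
      have "(\<Sum>j\<in>UNIV. cnj (z $ j) * (if i = j then 1 else 0)) = cnj (z $ i)"
      proof -
        have "(\<Sum>j\<in>UNIV. cnj (z $ j) * (if i = j then 1 else 0))
            = (\<Sum>j\<in>UNIV. if i = j then cnj (z $ j) else 0)"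
          by (intro sum.cong) auto
        then show ?thesis by simp
      qed
      then show "z $ i * (\<Sum>j\<in>UNIV. cnj (z $ j) * (if i = j then 1 else 0)) = of_real ((norm (z $ i))\<^sup>2)"
        by (simp only: complex_norm_square)
    qed simp
    also have "\<dots> = of_real ((norm z)\<^sup>2)"
    proof -
      have "(norm z)\<^sup>2 = (\<Sum>i\<in>UNIV. (norm (z $ i))\<^sup>2)"
        by (simp add: norm_vec_def L2_set_def sum_nonneg)
      then show ?thesis by (simp only: of_real_sum)
    qed
    finally show ?thesis by (simp only: of_real_eq_iff)
  qed
  have "inj ((*v) A)"
  proof (rule injI)
    fix x y assume "A *v x = A *v y"
    then have "A *v (x - y) = 0" by (simp add: matrix_vector_mult_diff_distrib)
    then have "(norm (x - y))\<^sup>2 = 0" using q[of "x - y"] scale[of 0 0] by simp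
    then show "x = y" by simp
  qed
  then have "invertible A" by (simp add: invertible_left_inverse matrix_left_invertible_injective)
  then show ?thesis using q by blast
qed

end

text \<open>Split the function into its even and odd parts about \<open>0\<close>. On lines through
  \<open>0\<close> the even part is, up to the constant, homogeneous of degree 2 and the odd part
  real linear. Exchanging the roles of \<open>y\<close> and \<open>d\<close> by homogeneity fixes
  the leading coefficients on all other lines.\<close>

lemma quadratic_on_lines_decompose:
  fixes \<phi> :: "complex ^ 'n \<Rightarrow> real"
  assumes line: "\<And>y d. \<exists>A \<alpha> \<beta>. \<forall>s. \<phi> (y + s *s d) = A * (norm s)\<^sup>2 + Re (\<alpha> * s) + \<beta>"
  shows "\<exists>h l. hermitian_quadratic h \<and> (\<forall>x y. l (x + y) = l x + l y) \<and> (\<forall>s x. l (s *s x) = s * l x)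
    \<and> (\<forall>x. \<phi> x = h x + Re (l x) + \<phi> 0)"
proof -
  define h where "h x = (\<phi> x + \<phi> (- x)) / 2 - \<phi> 0" for x
  define k where "k x = (\<phi> x - \<phi> (- x)) / 2" for x
  have radial: "\<exists>\<alpha>. \<forall>s. h (s *s d) = (norm s)\<^sup>2 * h d \<and> k (s *s d) = Re (\<alpha> * s)" for d
  proof -
    obtain A \<alpha> \<beta> where *: "\<And>s. \<phi> (0 + s *s d) = A * (norm s)\<^sup>2 + Re (\<alpha> * s) + \<beta>"
      using line by blast
    have **: "\<phi> (s *s d) = A * (norm s)\<^sup>2 + Re (\<alpha> * s) + \<beta>" for s using *[of s] by simp
    have 0: "\<phi> 0 = \<beta>" using **[of 0] by simp
    have "\<phi> (- (s *s d)) = A * (norm s)\<^sup>2 - Re (\<alpha> * s) + \<beta>" for s using **[of "- s"] by simp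
    then have hs: "h (s *s d) = (norm s)\<^sup>2 * A" "k (s *s d) = Re (\<alpha> * s)" for s
      by (simp_all only: h_def k_def ** 0) (simp_all add: field_simps)
    then have "h d = A" using hs(1)[of 1] by simp
    then show ?thesis using hs by blast
  qed
  have hsc: "h (s *s d) = (norm s)\<^sup>2 * h d" for s d using radial by blast
  have ksc: "k (of_real r *s d) = r * k d" for r d
  proof -
    obtain \<alpha> where "\<And>s. k (s *s d) = Re (\<alpha> * s)" using radial by blast
    from this[of "of_real r"] this[of 1] show ?thesis by simp
  qed
  have lines: "\<exists>A \<alpha> A' \<alpha>'. \<forall>s. h (y + s *s d) = A * (norm s)\<^sup>2 + Re (\<alpha> * s) + h y
      \<and> k (y + s *s d) = A' * (norm s)\<^sup>2 + Re (\<alpha>' * s) + k y" for y d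
  proof -
    obtain A \<alpha> \<beta> where 1: "\<And>s. \<phi> (y + s *s d) = A * (norm s)\<^sup>2 + Re (\<alpha> * s) + \<beta>"
      using line by blast
    obtain A' \<alpha>' \<beta>' where 2: "\<And>s. \<phi> (- y + s *s d) = A' * (norm s)\<^sup>2 + Re (\<alpha>' * s) + \<beta>'"
      using line by blast
    have 3: "\<phi> (- (y + s *s d)) = A' * (norm s)\<^sup>2 - Re (\<alpha>' * s) + \<beta>'" for s
      using 2[of "- s"] by simp
    have hy: "h y = (\<beta> + \<beta>') / 2 - \<phi> 0" "k y = (\<beta> - \<beta>') / 2"
      using 1[of 0] 2[of 0] by (simp_all add: h_def k_def)
    have "h (y + s *s d) = ((A + A') / 2) * (norm s)\<^sup>2 + Re ((\<alpha> - \<alpha>') / 2 * s) + h y"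
      and "k (y + s *s d) = ((A - A') / 2) * (norm s)\<^sup>2 + Re ((\<alpha> + \<alpha>') / 2 * s) + k y" for s
      unfolding hy unfolding h_def k_def 1 3 by (simp_all add: field_simps)
    then show ?thesis by blast
  qed
  have h_line: "\<exists>\<gamma>. \<forall>s. h (y + s *s d) = h y + (norm s)\<^sup>2 * h d + Re (\<gamma> * s)"
    and k_add: "k (y + d) = k y + k d" for y d
  proof -
    obtain A \<alpha> A' \<alpha>' where 1: "\<And>s. h (y + s *s d) = A * (norm s)\<^sup>2 + Re (\<alpha> * s) + h y"
      "\<And>s. k (y + s *s d) = A' * (norm s)\<^sup>2 + Re (\<alpha>' * s) + k y"
      using lines[of y d] by blast
    obtain C \<beta> C' \<beta>' where 2: "\<And>s. h (d + s *s y) = C * (norm s)\<^sup>2 + Re (\<beta> * s) + h d"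
      "\<And>s. k (d + s *s y) = C' * (norm s)\<^sup>2 + Re (\<beta>' * s) + k d"
      using lines[of d y] by blast
    have swap: "y + of_real r *s d = of_real r *s (d + of_real (1 / r) *s y)" if "r \<noteq> 0" for r
      using that by (simp add: vec_eq_iff algebra_simps)
    have h2: "h (y + of_real r *s d) = r\<^sup>2 * h (d + of_real (1 / r) *s y)" if "r \<noteq> 0" for r
      unfolding swap[OF that] hsc by simp
    have k2: "k (y + of_real r *s d) = r * k (d + of_real (1 / r) *s y)" if "r \<noteq> 0" for r
      unfolding swap[OF that] ksc ..
    have h3: "A * r\<^sup>2 + r * Re \<alpha> + h y = r\<^sup>2 * (C * (1/r)\<^sup>2 + (1/r) * Re \<beta> + h d)" if "r \<noteq> 0" for r
      using h2[OF that] unfolding 1 2 by (simp add: power2_eq_square norm_divide mult.commute)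
    have k3: "A' * r\<^sup>2 + r * Re \<alpha>' + k y = r * (C' * (1/r)\<^sup>2 + (1/r) * Re \<beta>' + k d)" if "r \<noteq> 0" for r
      using k2[OF that] unfolding 1 2 by (simp add: power2_eq_square norm_divide mult.commute)
    \<comment> \<open>Both sides of \<open>h3\<close> are polynomials of degree at most 2 in
      \<open>r\<close>, so three values of \<open>r\<close> suffice to compare leading
      coefficients.\<close>
    have "A = h d"
      using h3[of 1] h3[of "-1"] h3[of 2] by (simp add: power2_eq_square)
    then show "\<exists>\<gamma>. \<forall>s. h (y + s *s d) = h y + (norm s)\<^sup>2 * h d + Re (\<gamma> * s)"
      using 1(1) by (intro exI[of _ \<alpha>]) (simp add: mult.commute)
    \<comment> \<open>Multiplied by \<open>r\<close>, the equation \<open>k3\<close> says that a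
      cubic in \<open>r\<close> vanishes; four nonzero values of \<open>r\<close> kill all its
      coefficients.\<close>
    have "A' = 0" "Re \<alpha>' = k d"
      using k3[of 1] k3[of "-1"] k3[of 2] k3[of "-2"] by (simp_all add: power2_eq_square)
    then show "k (y + d) = k y + k d" using 1(2)[of 1] by simp
  qed
  \<comment> \<open>The unique complex linear form with real part \<open>k\<close>.\<close>
  define l where "l x = Complex (k x) (- k (\<i> *s x))" for x
  have "l (x + y) = l x + l y" for x y
    by (simp add: l_def complex_eq_iff k_add vector_add_ldistrib)
  moreover have "l (s *s x) = s * l x" for s x
  proof -
    obtain \<alpha> where \<alpha>: "\<And>s. k (s *s x) = Re (\<alpha> * s)" using radial by blast
    have "k x = Re \<alpha>" using \<alpha>[of 1] by simp
    moreover have "k (\<i> *s (s *s x)) = Re (\<alpha> * (\<i> * s))" by (simp only: vector_smult_assoc \<alpha>)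
    ultimately show ?thesis by (simp add: l_def complex_eq_iff \<alpha> algebra_simps)
  qed
  moreover have "hermitian_quadratic h"
    unfolding hermitian_quadratic_def using hsc h_line by blast
  moreover have "\<phi> x = h x + Re (l x) + \<phi> 0" for x
    by (simp add: h_def l_def k_def field_simps)
  ultimately show ?thesis by blast
qed

section \<open>Bodies whose line sections are discs\<close>

lemma norm_smult_vec: "norm (t *s v) = norm t * norm (v :: complex ^ 'n)"
  by (simp add: norm_vec_def norm_mult L2_set_right_distrib)

definition hdot :: "complex ^ 'n \<Rightarrow> complex ^ 'n \<Rightarrow> complex" where
  "hdot x a = (\<Sum>i\<in>UNIV. x $ i * cnj (a $ i))"

lemma Re_hdot: "Re (hdot x a) = x \<bullet> a"
  by (simp add: hdot_def inner_vec_def inner_complex_def)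

lemma hdot_add: "hdot (x + y) a = hdot x a + hdot y a"
  by (simp add: hdot_def algebra_simps sum.distrib)

lemma hdot_scale: "hdot (s *s x) a = s * hdot x a"
  by (simp add: hdot_def sum_distrib_left mult.assoc)

lemma hdot_diff: "hdot (x - y) a = hdot x a - hdot y a"
  by (simp add: hdot_def algebra_simps sum_subtractf)

lemma hdot_self: "hdot x x = of_real ((norm x)\<^sup>2)"
proof -
  have "Im (hdot x x) = 0" by (simp add: hdot_def mult.commute)
  moreover have "Re (hdot x x) = (norm x)\<^sup>2" by (simp add: Re_hdot power2_norm_eq_inner)
  ultimately show ?thesis by (simp add: complex_eq_iff)
qed

lemma hdot_matrix: "\<exists>w. \<forall>z. hdot (A *v z) e = hdot z w" for A :: "complex ^ 'n ^ 'n"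
proof -
  define w where "w = (\<chi> j. \<Sum>i\<in>UNIV. cnj (A $ i $ j) * e $ i)"
  have "hdot (A *v z) e = hdot z w" for z
  proof -
    have "hdot (A *v z) e = (\<Sum>i\<in>UNIV. \<Sum>j\<in>UNIV. z $ j * (A $ i $ j * cnj (e $ i)))"
      by (simp add: hdot_def matrix_vector_mult_def sum_distrib_right sum_distrib_left mult_ac)
    also have "\<dots> = (\<Sum>j\<in>UNIV. \<Sum>i\<in>UNIV. z $ j * (A $ i $ j * cnj (e $ i)))"
      by (rule sum.swap)
    also have "\<dots> = hdot z w"
      by (simp add: hdot_def w_def sum_distrib_left)
    finally show ?thesis .
  qed
  then show ?thesis by blast
qed

text \<open>The half-plane contains the disc and has the disc's point \<open>0\<close> on its edge,
  so it is tangent there. Testing the point of the disc that minimises \<open>Re (t * f)\<close>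
  gives \<open>r * norm f \<le> Re (c * f) \<le> norm (c * f) \<le> r * norm f\<close>.\<close>

lemma tangent_disc:
  fixes c f :: complex
  assumes "0 \<in> cball c r" and f: "\<And>t. t \<in> cball c r \<Longrightarrow> Re (t * f) \<ge> 0"
  shows "c * f = of_real (r * norm f)"
proof (cases "f = 0")
  case False
  have cr: "norm c \<le> r" using assms(1) by simp
  then have r: "r \<ge> 0" using norm_ge_zero order_trans by blast
  define t where "t = c - of_real r * cnj f / norm f"
  have "t \<in> cball c r" using r False by (simp add: t_def dist_norm norm_mult norm_divide)
  then have "0 \<le> Re (t * f)" by (rule f)
  also have "t * f = c * f - of_real (r * norm f)"
  proof -
    have "cnj f * f = of_real (norm f) * of_real (norm f)"
      using complex_norm_square[of f] by (simp add: power2_eq_square mult.commute)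
    then have "of_real r * cnj f / norm f * f = of_real (r * norm f)" using False by (simp add: field_simps)
    then show ?thesis by (simp add: t_def left_diff_distrib)
  qed
  finally have 1: "r * norm f \<le> Re (c * f)" by simp
  have 2: "norm (c * f) \<le> r * norm f" using cr by (simp add: norm_mult mult_right_mono)
  have 3: "Re (c * f) \<le> norm (c * f)" by (rule complex_Re_le_cmod)
  have "(norm (c * f))\<^sup>2 = (Re (c * f))\<^sup>2 + (Im (c * f))\<^sup>2" by (rule cmod_power2)
  moreover have "norm (c * f) = Re (c * f)" using 1 2 3 by linarith
  ultimately have "Im (c * f) = 0" by (metis add_cancel_left_right zero_eq_power2)
  moreover have "Re (c * f) = r * norm f" using 1 2 3 by linarith
  ultimately show ?thesis by (simp only: complex_eq_iff) simp
qed simp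

text \<open>Pulled back to the parameter plane, so that sections on different lines can be compared
  inside the complex numbers; another choice of \<open>p\<close> and \<open>v\<close> on the same
  line changes it by a complex affine map.\<close>

definition line_section :: "(complex ^ 'n) set \<Rightarrow> complex ^ 'n \<Rightarrow> complex ^ 'n \<Rightarrow> complex set" where
  "line_section K p v = {t. p + t *s v \<in> K}"

text \<open>The body after translating its farthest point to \<open>0\<close>: the inequality
  \<open>in_ball\<close> says \<open>norm (x - e) \<le> norm e\<close>, that is, \<open>K\<close>
  lies in a ball with \<open>0\<close> on its boundary.\<close>

locale pinned_body =
  fixes K :: "(complex ^ 'n) set" and e :: "complex ^ 'n"
  assumes body: "convex_body K"
    and disc: "\<And>p v. v \<noteq> 0 \<Longrightarrow> \<exists>c r. line_section K p v = cball c r"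
    and zero: "0 \<in> K"
    and in_ball: "\<And>x. x \<in> K \<Longrightarrow> (norm x)\<^sup>2 \<le> 2 * (x \<bullet> e)"
begin

definition F where "F x = hdot x e"

lemma F_add: "F (x + y) = F x + F y" and F_diff: "F (x - y) = F x - F y" and F_scale: "F (s *s x) = s * F x"
  and Re_F: "Re (F x) = x \<bullet> e" and F_zero: "F 0 = 0"
  by (simp_all add: F_def hdot_add hdot_diff hdot_scale Re_hdot) (simp add: hdot_def)

lemma body': "compact K" "convex K" "interior K \<noteq> {}"
  using body by (auto simp: convex_body_def)

lemma Re_F_nonneg: "x \<in> K \<Longrightarrow> 0 \<le> Re (F x)"
  using in_ball[of x] by (simp add: Re_F) (smt (verit) zero_le_power2)

text \<open>The tangent complex hyperplane of the enclosing ball touches \<open>K\<close> only at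
  \<open>0\<close>, so \<open>1 / F x\<close> is defined on the rest of \<open>K\<close>.\<close>

lemma F_ne_0: "x \<in> K \<Longrightarrow> x \<noteq> 0 \<Longrightarrow> F x \<noteq> 0"
  using in_ball[of x] Re_F[of x] by fastforce

text \<open>The real hyperplane \<open>Re (F x) = 0\<close> is the only supporting hyperplane at \<open>0\<close>: a supporting functional
  is determined up to a real factor on each line through \<open>0\<close> and the interior, since a disc has a unique
  tangent at a boundary point.\<close>

lemma support_phase:
  assumes a: "\<And>x. x \<in> K \<Longrightarrow> 0 \<le> x \<bullet> a" and w: "w \<in> interior K" "w \<noteq> 0"
  shows "Im (F w * cnj (hdot w a)) = 0"
proof -
  obtain c r where cr: "line_section K 0 w = cball c r" using disc w by blast
  have D: "t *s w \<in> K \<longleftrightarrow> t \<in> cball c r" for t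
    using cr by (auto simp: line_section_def)
  have wK: "w \<in> K" using w interior_subset by blast
  have 0: "0 \<in> cball c r" using D[of 0] zero by simp
  have cF: "c * F w = of_real (r * norm (F w))"
    using 0 Re_F_nonneg D by (intro tangent_disc) (metis F_scale)+
  have cG: "c * hdot w a = of_real (r * norm (hdot w a))"
    using 0 a D by (intro tangent_disc) (metis hdot_scale Re_hdot)+
  have "c \<noteq> 0"
  proof
    assume "c = 0"
    then have "r = 0" using cF F_ne_0[OF wK w(2)] by simp
    then show False using D[of 1] \<open>c = 0\<close> wK by simp
  qed
  \<comment> \<open>Both \<open>c * F w\<close> and \<open>c * hdot w a\<close> are real, so
    multiplying one by the conjugate of the other eliminates the phase of \<open>c\<close>.\<close>
  have "(c * cnj c) * (F w * cnj (hdot w a)) = (c * F w) * cnj (c * hdot w a)" by simp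
  also have "\<dots> = of_real (r * norm (F w) * (r * norm (hdot w a)))" by (simp only: cF cG) simp
  finally have "of_real ((norm c)\<^sup>2) * (F w * cnj (hdot w a)) = of_real (r * norm (F w) * (r * norm (hdot w a)))"
    by (simp only: complex_norm_square)
  from arg_cong[OF this, of Im] have "(norm c)\<^sup>2 * Im (F w * cnj (hdot w a)) = 0"
    by (simp only: times_complex.sel Re_complex_of_real Im_complex_of_real mult_zero_left add_0_right)
  then show ?thesis using \<open>c \<noteq> 0\<close> by simp
qed

text \<open>Otherwise the complex line through \<open>v\<close> misses the interior and is separated
  from it by a real functional \<open>a\<close>, for which \<open>hdot v a = 0\<close>. Moving an
  interior point \<open>w\<close> along \<open>v\<close> then changes \<open>F w\<close> in every
  complex direction but leaves \<open>hdot w a\<close> fixed, so \<open>support_phase\<close> forces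
  \<open>hdot w a = 0\<close> throughout the interior, contradicting
  \<open>a \<noteq> 0\<close>.\<close>

lemma section_nontrivial:
  assumes v: "F v \<noteq> 0"
  shows "\<exists>t. t \<noteq> 0 \<and> t *s v \<in> K"
proof (rule ccontr)
  assume "\<not> (\<exists>t. t \<noteq> 0 \<and> t *s v \<in> K)"
  then have no: "t *s v \<notin> K" if "t \<noteq> 0" for t using that by blast
  have e: "e \<noteq> 0" using v by (auto simp: F_def hdot_def)
  have zero_int: "0 \<notin> interior K"
  proof
    assume "0 \<in> interior K"
    then obtain \<epsilon> where \<epsilon>: "\<epsilon> > 0" "cball 0 \<epsilon> \<subseteq> K" by (auto simp: mem_interior_cball)
    define x where "x = (- \<epsilon> / norm e) *\<^sub>R e"
    have "x \<in> cball 0 \<epsilon>" using \<epsilon>(1) e by (simp add: x_def)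
    then have "0 \<le> x \<bullet> e" using \<epsilon>(2) Re_F_nonneg by (auto simp: Re_F)
    moreover have "x \<bullet> e = - \<epsilon> * norm e" using e by (simp add: x_def flip: power2_norm_eq_inner)
        (simp add: power2_eq_square)
    ultimately show False using \<epsilon>(1) e by (simp add: mult_le_0_iff zero_le_mult_iff)
  qed
  define L where "L = range (\<lambda>t. t *s v)"
  have "convex L"
  proof (rule convexI)
    fix x y and s t :: real assume "x \<in> L" "y \<in> L" "0 \<le> s" "0 \<le> t" "s + t = 1"
    then obtain a b where ab: "x = a *s v" "y = b *s v" by (auto simp: L_def)
    have "s *\<^sub>R x + t *\<^sub>R y = (s *\<^sub>R a + t *\<^sub>R b) *s v"
      by (simp add: ab vec_eq_iff algebra_simps)
    then show "s *\<^sub>R x + t *\<^sub>R y \<in> L" unfolding L_def by (rule range_eqI)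
  qed
  moreover have "L \<inter> interior K = {}"
  proof -
    have "t *s v \<notin> interior K" for t
      using zero_int no[of t] interior_subset[of K] by (cases "t = 0") auto
    then show ?thesis by (auto simp: L_def)
  qed
  moreover have "L \<noteq> {}" by (auto simp: L_def)
  moreover have "convex (interior K)" using body'(2) by (rule convex_interior)
  ultimately obtain a b where a: "a \<noteq> 0" "\<And>x. x \<in> L \<Longrightarrow> a \<bullet> x \<le> b" "\<And>x. x \<in> interior K \<Longrightarrow> b \<le> a \<bullet> x"
    using separating_hyperplane_sets[of L "interior K"] body'(3) by blast
  have "0 *s v \<in> L" unfolding L_def by blast
  then have b: "0 \<le> b" using a(2)[of 0] by simp
  \<comment> \<open>A complex linear function with real part bounded above on a whole complex line
    through \<open>0\<close> vanishes on it.\<close>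
  have av: "hdot v a = 0"
  proof (rule ccontr)
    assume ne: "hdot v a \<noteq> 0"
    define t where "t = of_real (b + 1) / hdot v a"
    have "t *s v \<in> L" by (auto simp: L_def)
    moreover have "a \<bullet> (t *s v) = Re (t * hdot v a)"
      by (simp only: hdot_scale[symmetric] Re_hdot inner_commute)
    moreover have "t * hdot v a = of_real (b + 1)" using ne by (simp add: t_def)
    ultimately show False using a(2)[of "t *s v"] by simp
  qed
  have "K \<subseteq> closure (interior K)"
    using convex_closure_interior[OF body'(2,3)] closure_subset by blast
  also have "\<dots> \<subseteq> {x. a \<bullet> x \<ge> 0}"
    using a(3) b by (intro closure_minimal closed_halfspace_ge) force
  finally have aK: "0 \<le> x \<bullet> a" if "x \<in> K" for x using that by (auto simp: inner_commute)
  have aint: "hdot w a = 0" if w: "w \<in> interior K" for w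
  proof -
    obtain \<epsilon> where \<epsilon>: "\<epsilon> > 0" "ball w \<epsilon> \<subseteq> interior K"
      using w open_interior open_contains_ball by blast
    define \<delta> where "\<delta> = \<epsilon> / 2 / (norm v + 1)"
    have nv: "norm v + 1 > 0" using norm_ge_zero[of v] by linarith
    have \<delta>: "\<delta> > 0" using \<epsilon>(1) nv by (simp add: \<delta>_def)
    have "\<delta> * norm v < \<epsilon>"
    proof -
      have "\<delta> * norm v \<le> \<delta> * (norm v + 1)" using \<delta> by simp
      also have "\<dots> = \<epsilon> / 2"
        using nv \<delta>_def nonzero_divide_eq_eq[of "norm v + 1" "\<epsilon> / 2" \<delta>] by simp
      finally show ?thesis using \<epsilon>(1) by linarith
    qed
    have int: "w + t *s v \<in> interior K" if "norm t \<le> \<delta>" for t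
    proof -
      have "norm t * norm v \<le> \<delta> * norm v" using that by (simp add: mult_right_mono)
      then have "w + t *s v \<in> ball w \<epsilon>" using \<open>\<delta> * norm v < \<epsilon>\<close> by (simp add: dist_norm norm_smult_vec)
      then show ?thesis using \<epsilon>(2) by blast
    qed
    have "Im ((F w + t * F v) * cnj (hdot w a)) = 0" if "norm t \<le> \<delta>" for t
      using support_phase[OF aK int[OF that]] int[OF that] zero_int
      by (cases "w + t *s v = 0") (auto simp: F_add F_scale hdot_add hdot_scale av)
    note * = this[of 0] this[of "of_real \<delta>"] this[of "\<i> * of_real \<delta>"]
    have "\<delta> * Im (F v * cnj (hdot w a)) = 0" "\<delta> * Re (F v * cnj (hdot w a)) = 0"
      using * \<delta> by (simp_all add: norm_mult algebra_simps)
    then have "F v * cnj (hdot w a) = 0" using \<delta> by (simp add: complex_eq_iff)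
    then show ?thesis using v by simp
  qed
  obtain w where w: "w \<in> interior K" using body'(3) by blast
  obtain \<epsilon> where \<epsilon>: "\<epsilon> > 0" "ball w \<epsilon> \<subseteq> interior K"
    using w open_interior open_contains_ball by blast
  define x where "x = w + (\<epsilon> / (2 * norm a)) *\<^sub>R a"
  have "x \<in> ball w \<epsilon>" using \<epsilon>(1) a(1) by (simp add: x_def dist_norm)
  then have "hdot x a = 0" "hdot w a = 0" using aint \<epsilon>(2) w by blast+
  then have "x \<bullet> a = 0" "w \<bullet> a = 0" by (metis Re_hdot zero_complex.sel(1))+
  then have "(\<epsilon> / (2 * norm a)) * (a \<bullet> a) = 0" by (simp add: x_def inner_add_left)
  then show False using \<epsilon>(1) a(1) by simp
qed

text \<open>The section is a disc tangent to the imaginary axis at \<open>0\<close>, so its centre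
  equals its radius \<open>r\<close> and \<rho> is \<open>1 / (2 * r)\<close>. For
  \<open>t \<noteq> 0\<close> the condition reads \<open>Re (1 / t) \<ge> \<rho>\<close>, a
  half-plane.\<close>

lemma section_through_zero:
  assumes v: "F v = 1"
  shows "\<exists>\<rho>>0. \<forall>t. t *s v \<in> K \<longleftrightarrow> \<rho> * (norm t)\<^sup>2 \<le> Re t"
proof -
  have "v \<noteq> 0" using v F_zero by auto
  then obtain c r where cr: "line_section K 0 v = cball c r" using disc by blast
  have D: "t *s v \<in> K \<longleftrightarrow> t \<in> cball c r" for t
    using cr by (auto simp: line_section_def)
  have "0 \<in> cball c r" using D[of 0] zero by simp
  moreover have "Re (t * 1) \<ge> 0" if "t \<in> cball c r" for t
    using that Re_F_nonneg[of "t *s v"] D[of t] by (simp add: F_scale v)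
  ultimately have c: "c = of_real r" using tangent_disc[of c r 1] by simp
  obtain t where t: "t \<noteq> 0" "t *s v \<in> K" using section_nontrivial[of v] v by auto
  have sq: "s *s v \<in> K \<longleftrightarrow> (norm s)\<^sup>2 \<le> 2 * r * Re s" if "r \<ge> 0" for s
  proof -
    have "s *s v \<in> K \<longleftrightarrow> (norm (s - r))\<^sup>2 \<le> r\<^sup>2"
      unfolding D c using that by (simp add: dist_norm norm_minus_commute abs_le_square_iff[symmetric])
    moreover have "(norm (s - r))\<^sup>2 = (norm s)\<^sup>2 - 2 * r * Re s + r\<^sup>2"
      unfolding cmod_power2 by (simp add: power2_eq_square algebra_simps)
    ultimately show ?thesis by linarith
  qed
  have "r \<ge> 0" using \<open>0 \<in> cball c r\<close> by (metis cball_eq_empty empty_iff not_le)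
  moreover have "r \<noteq> 0" using sq[of t] t by auto
  ultimately have r: "r > 0" by simp
  have "\<forall>s. s *s v \<in> K \<longleftrightarrow> 1 / (2 * r) * (norm s)\<^sup>2 \<le> Re s"
    using sq r by (simp add: field_simps)
  then show ?thesis using r by (intro exI[of _ "1 / (2 * r)"]) simp
qed

end

section \<open>Inversion of discs and the projective chart at the pinned point\<close>

text \<open>Multiplying the disc inequality by \<open>norm w\<close> and squaring gives
  \<open>N * (norm w)\<^sup>2 - 2 * Re (c * w) + 1 \<le> 0\<close>; completing the square shows the
  new centre and radius. \<open>N\<close> is the power of \<open>0\<close> with respect to the
  circle, positive because \<open>0\<close> lies outside.\<close>

lemma inverse_in_cball_iff:
  fixes c w :: complex
  assumes "0 \<le> r" "r < norm c"
  defines "N \<equiv> (norm c)\<^sup>2 - r\<^sup>2"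
  shows "w \<noteq> 0 \<and> inverse w \<in> cball c r \<longleftrightarrow> w \<in> cball (cnj c / of_real N) (r / N)"
proof -
  have N: "N > 0" using assms by (simp add: power_strict_mono)
  have "w \<in> cball (cnj c / of_real N) (r / N) \<longleftrightarrow> (norm (w - cnj c / of_real N))\<^sup>2 \<le> (r / N)\<^sup>2"
    using assms(1) N by (simp add: dist_norm norm_minus_commute flip: abs_le_square_iff)
  also have "(norm (w - cnj c / of_real N))\<^sup>2 = (norm w)\<^sup>2 - 2 * Re (c * w) / N + (norm c)\<^sup>2 / N\<^sup>2"
    unfolding cmod_power2 using N by (simp add: power2_eq_square field_simps)
  also have "\<dots> \<le> (r / N)\<^sup>2 \<longleftrightarrow> (norm w)\<^sup>2 - 2 * Re (c * w) / N + N / N\<^sup>2 \<le> 0"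
  proof -
    have "(r / N)\<^sup>2 = (norm c)\<^sup>2 / N\<^sup>2 - N / N\<^sup>2"
      by (simp add: N_def power_divide diff_divide_distrib[symmetric])
    then show ?thesis by linarith
  qed
  also have "\<dots> \<longleftrightarrow> N * (norm w)\<^sup>2 - 2 * Re (c * w) + 1 \<le> 0"
  proof -
    have "N * (norm w)\<^sup>2 - 2 * Re (c * w) + 1 = N * ((norm w)\<^sup>2 - 2 * Re (c * w) / N + N / N\<^sup>2)"
      using N unfolding distrib_left right_diff_distrib by (simp add: power2_eq_square)
    then show ?thesis using N by (simp only: mult_le_0_iff) auto
  qed
  also have "\<dots> \<longleftrightarrow> w \<noteq> 0 \<and> inverse w \<in> cball c r"
  proof (cases "w = 0")
    case False
    have "inverse w \<in> cball c r \<longleftrightarrow> norm (c - inverse w) * norm w \<le> r * norm w"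
      using False by (simp add: dist_norm)
    also have "norm (c - inverse w) * norm w = norm (c * w - 1)"
      using False by (simp add: left_diff_distrib flip: norm_mult)
    also have "norm (c * w - 1) \<le> r * norm w \<longleftrightarrow> (norm (c * w - 1))\<^sup>2 \<le> (r * norm w)\<^sup>2"
      using assms(1) by (simp flip: abs_le_square_iff)
    also have "(norm (c * w - 1))\<^sup>2 = (norm (c * w))\<^sup>2 - 2 * Re (c * w) + 1"
      unfolding cmod_power2[of "c * w"] cmod_power2[of "c * w - 1"]
      by (simp only: minus_complex.sel one_complex.sel) (simp add: power2_eq_square algebra_simps)
    also have "\<dots> \<le> (r * norm w)\<^sup>2 \<longleftrightarrow> N * (norm w)\<^sup>2 - 2 * Re (c * w) + 1 \<le> 0"
      by (simp only: N_def norm_mult power_mult_distrib left_diff_distrib) linarith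
    finally show ?thesis using False by blast
  qed simp
  finally show ?thesis by blast
qed

context pinned_body
begin

text \<open>In the coordinate \<open>1 / t\<close> on the line through \<open>0\<close> and
  \<open>v\<close>, the body becomes the half-plane of real parts at least \<open>phi v\<close>. The
  choice is meaningful for \<open>F v = 1\<close>.\<close>

definition phi where "phi v = (SOME \<rho>. \<rho> > 0 \<and> (\<forall>t. t *s v \<in> K \<longleftrightarrow> \<rho> * (norm t)\<^sup>2 \<le> Re t))"

lemma phi:
  assumes "F v = 1"
  shows "phi v > 0" and "t *s v \<in> K \<longleftrightarrow> phi v * (norm t)\<^sup>2 \<le> Re t"
  using someI_ex[OF section_through_zero[OF assms], folded phi_def] by blast+

text \<open>The projective map \<open>x \<mapsto> (x / F x, 1 / F x)\<close> sends the lines not through \<open>0\<close> to the graphs of complex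
  affine functions over lines of \<open>{F = 1}\<close>, and discs avoiding \<open>F = 0\<close> to discs.\<close>

lemma phi_sublevel_disc:
  assumes v: "F v = 1" and d: "F d = 0" "d \<noteq> 0"
  shows "\<exists>c r. {s. phi (v + s *s d) \<le> Re (\<alpha> * s) + \<beta>} = cball c r"
proof -
  define w where "w s = \<alpha> * s + of_real \<beta>" for s
  define E where "E = {s. phi (v + s *s d) \<le> Re (\<alpha> * s) + \<beta>}"
  have E: "s \<in> E \<longleftrightarrow> w s \<noteq> 0 \<and> inverse (w s) *s (v + s *s d) \<in> K" for s
  proof -
    have F1: "F (v + s *s d) = 1" using v d by (simp add: F_add F_scale)
    have Ew: "s \<in> E \<longleftrightarrow> phi (v + s *s d) \<le> Re (w s)" by (simp add: E_def w_def)
    show ?thesis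
    proof (cases "w s = 0")
      case False
      have i1: "Re (inverse (w s)) = Re (w s) / (norm (w s))\<^sup>2" by (simp add: cmod_power2)
      have i2: "(norm (inverse (w s)))\<^sup>2 = 1 / (norm (w s))\<^sup>2"
        by (simp add: norm_inverse power_inverse divide_inverse)
      have "inverse (w s) *s (v + s *s d) \<in> K
          \<longleftrightarrow> phi (v + s *s d) / (norm (w s))\<^sup>2 \<le> Re (w s) / (norm (w s))\<^sup>2"
        by (simp only: phi(2)[OF F1] i1 i2) simp
      also have "\<dots> \<longleftrightarrow> phi (v + s *s d) \<le> Re (w s)" using False by (simp add: divide_le_cancel)
      finally show ?thesis using False Ew by blast
    next
      case True
      then show ?thesis using Ew phi(1)[OF F1] by simp
    qed
  qed
  have "\<exists>c r. E = cball c r"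
  \<comment> \<open>For constant \<open>w\<close> the points examined run along a line parallel to
    the hyperplane \<open>F = 0\<close>, or the sublevel set is empty since \<open>phi > 0\<close>.
    Otherwise they form the line \<open>p + t *s u\<close> with \<open>t = 1 / w s\<close>.\<close>
  proof (cases "\<alpha> = 0")
    case True
    show ?thesis
    proof (cases "\<beta> = 0")
      case True
      then have "E = cball 0 (- 1)" using E \<open>\<alpha> = 0\<close> by (auto simp: w_def)
      then show ?thesis by blast
    next
      case False
      define b where "b = inverse (complex_of_real \<beta>)"
      have "E = line_section K (b *s v) (b *s d)"
        using E False \<open>\<alpha> = 0\<close>
        by (auto simp: w_def line_section_def b_def vector_add_ldistrib vector_smult_assoc mult.commute)
      moreover have "b *s d \<noteq> 0" using d False by (simp add: b_def vector_mul_eq_0)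
      ultimately show ?thesis using disc by metis
    qed
  next
    case False
    define p where "p = inverse \<alpha> *s d"
    define u where "u = v - (of_real \<beta> / \<alpha>) *s d"
    have "F u = 1" using v d by (simp add: u_def F_diff F_scale)
    then have "u \<noteq> 0" using F_zero by auto
    then obtain c r where cr: "line_section K p u = cball c r" using disc by blast
    have D: "p + t *s u \<in> K \<longleftrightarrow> t \<in> cball c r" for t using cr by (auto simp: line_section_def)
    have "inverse (w s) *s (v + s *s d) = p + inverse (w s) *s u" if "w s \<noteq> 0" for s
    proof -
      have "inverse (w s) * s = inverse \<alpha> - inverse (w s) * (of_real \<beta> / \<alpha>)"
        using that False by (simp add: field_simps) (simp add: w_def algebra_simps)
      then have "inverse (w s) * (s * x) = inverse \<alpha> * x - inverse (w s) * (of_real \<beta> / \<alpha> * x)" for x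
        by (metis left_diff_distrib mult.assoc)
      then show ?thesis
        by (simp add: vec_eq_iff p_def u_def right_diff_distrib distrib_left mult.assoc)
    qed
    then have E': "s \<in> E \<longleftrightarrow> w s \<noteq> 0 \<and> inverse (w s) \<in> cball c r" for s
      using E[of s] D[of "inverse (w s)"] by auto
    \<comment> \<open>The point \<open>p\<close> corresponds to the parameter \<open>0\<close>; it
      lies in the hyperplane at infinity, hence outside \<open>K\<close>, so the disc can be
      inverted.\<close>
    have "p \<noteq> 0" "F p = 0" using d False by (simp_all add: p_def F_scale vector_mul_eq_0)
    then have "p \<notin> K" using F_ne_0 by blast
    then have c0: "r < norm c" using D[of 0] by auto
    show ?thesis
    proof (cases "r < 0")
      case True
      then have "E = cball 0 (- 1)" using E' by auto
      then show ?thesis by blast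
    next
      case False
      define N where "N = (norm c)\<^sup>2 - r\<^sup>2"
      define q where "q = cnj c / of_real N - of_real \<beta>"
      have "s \<in> E \<longleftrightarrow> s \<in> cball (q / \<alpha>) (r / N / norm \<alpha>)" for s
      proof -
        have "s \<in> E \<longleftrightarrow> w s \<in> cball (cnj c / of_real N) (r / N)"
          using E' inverse_in_cball_iff[of r c] False c0 by (simp add: N_def)
        also have "\<dots> \<longleftrightarrow> norm (q - \<alpha> * s) \<le> r / N"
          by (simp add: dist_norm w_def q_def algebra_simps)
        also have "q - \<alpha> * s = \<alpha> * (q / \<alpha> - s)"
          using \<open>\<alpha> \<noteq> 0\<close> by (simp add: right_diff_distrib)
        also have "norm \<dots> \<le> r / N \<longleftrightarrow> norm (q / \<alpha> - s) \<le> r / N / norm \<alpha>"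
          unfolding norm_mult using \<open>\<alpha> \<noteq> 0\<close> by (subst pos_le_divide_eq) (simp_all add: mult.commute)
        finally show ?thesis by (simp add: dist_norm)
      qed
      then show ?thesis by blast
    qed
  qed
  then show ?thesis by (simp add: E_def)
qed

lemma phi_line_quadratic:
  assumes "F v = 1" "F d = 0" "d \<noteq> 0"
  shows "\<exists>A \<alpha> \<beta>. A > 0 \<and> (\<forall>s. phi (v + s *s d) = A * (norm s)\<^sup>2 + Re (\<alpha> * s) + \<beta>)"
proof -
  interpret disc_sublevels "\<lambda>s. phi (v + s *s d)"
    using phi_sublevel_disc[OF assms] by unfold_locales
  show ?thesis by (rule quadratic)
qed

text \<open>On \<open>F = 1\<close> the function \<open>phi\<close> is a quadratic polynomial.
  Substituting \<open>v = x / F x\<close> in the half-plane description and multiplying by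
  \<open>(norm (F x))\<^sup>2\<close> makes it a Hermitian quadratic form in
  \<open>x\<close>.\<close>

lemma quadric:
  "\<exists>P. hermitian_quadratic P \<and> (\<forall>x. x \<in> K \<longleftrightarrow> P x \<le> x \<bullet> e)"
proof -
  have "e \<noteq> 0"
  proof
    assume "e = 0"
    then have "K \<subseteq> {0}" using in_ball by force
    then have "interior K \<subseteq> interior {0}" by (rule interior_mono)
    then show False using body'(3) by simp
  qed
  define v0 where "v0 = of_real (1 / (norm e)\<^sup>2) *s e"
  have v0: "F v0 = 1"
  proof -
    have "F e = of_real ((norm e)\<^sup>2)" by (simp only: F_def hdot_self)
    then show ?thesis using \<open>e \<noteq> 0\<close> by (simp add: v0_def F_scale)
  qed
  \<comment> \<open>Extends \<open>phi\<close> from \<open>F = 1\<close> to the whole space,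
    constantly along \<open>v0\<close>, so that the decomposition on a vector space applies.\<close>
  define \<phi> where "\<phi> x = phi (v0 + (x - F x *s v0))" for x
  have "\<exists>A \<alpha> \<beta>. \<forall>s. \<phi> (y + s *s d) = A * (norm s)\<^sup>2 + Re (\<alpha> * s) + \<beta>" for y d
  proof -
    define v' where "v' = v0 + (y - F y *s v0)"
    define d' where "d' = d - F d *s v0"
    have F': "F v' = 1" "F d' = 0" by (simp_all add: v'_def d'_def F_add F_diff F_scale v0)
    have eq: "\<phi> (y + s *s d) = phi (v' + s *s d')" for s
    proof -
      have "v0 + ((y + s *s d) - F (y + s *s d) *s v0) = v' + s *s d'"
        by (simp add: vec_eq_iff v'_def d'_def F_add F_scale algebra_simps)
      then show ?thesis by (simp only: \<phi>_def)
    qed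
    show ?thesis
    proof (cases "d' = 0")
      case True
      then show ?thesis by (intro exI[of _ 0] exI[of _ "phi v'"]) (simp add: eq)
    next
      case False
      then show ?thesis using phi_line_quadratic[OF F'] by (simp only: eq) blast
    qed
  qed
  from quadratic_on_lines_decompose[OF this] obtain h l where h: "hermitian_quadratic h"
    and l: "\<And>x y. l (x + y) = l x + l y" "\<And>s x. l (s *s x) = s * l x"
    and \<phi>: "\<And>x. \<phi> x = h x + Re (l x) + \<phi> 0" by blast
  have hs: "h (s *s x) = (norm s)\<^sup>2 * h x" for s x
    using h by (simp add: hermitian_quadratic_def)
  have hpos: "h d > 0" if d: "F d = 0" "d \<noteq> 0" for d
  proof -
    obtain A \<alpha> \<beta> where A: "A > 0" "\<And>s. phi (v0 + s *s d) = A * (norm s)\<^sup>2 + Re (\<alpha> * s) + \<beta>"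
      using phi_line_quadratic[OF v0 d] by blast
    have "\<phi> (s *s d) = phi (v0 + s *s d)" for s
      using d by (simp add: \<phi>_def F_scale)
    then have "(norm s)\<^sup>2 * h d + Re (s * l d) + \<phi> 0 = A * (norm s)\<^sup>2 + Re (\<alpha> * s) + \<beta>" for s
      using \<phi>[of "s *s d"] A(2)[of s] by (simp only: hs l)
    from this[of 0] this[of 1] this[of "-1"] have "h d = A" by simp
    then show ?thesis using A(1) by simp
  qed
  \<comment> \<open>Homogenisation: the linear part and the constant of \<phi> are raised to degree
    2 with the linear form \<open>F\<close>.\<close>
  define G where "G x = l x + of_real (\<phi> 0) * F x" for x
  define P where "P x = h x + Re (cnj (F x) * G x)" for x
  have "hermitian_quadratic P"
    unfolding P_def using h
    by (intro hermitian_quadratic_add hermitian_quadratic_product)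
      (simp_all add: G_def F_add F_scale l algebra_simps)
  moreover have "x \<in> K \<longleftrightarrow> P x \<le> x \<bullet> e" for x
  proof (cases "F x = 0")
    case True
    have "h 0 = 0" using hs[of 0 0] by simp
    then have "x \<in> K \<longleftrightarrow> h x \<le> 0" using F_ne_0[of x] hpos[of x] True zero
      by (cases "x = 0") force+
    then show ?thesis using True Re_F[of x] by (simp add: P_def)
  next
    case False
    define t where "t = F x"
    define v where "v = inverse t *s x"
    have t: "t \<noteq> 0" using False by (simp add: t_def)
    have x: "x = t *s v" using t by (simp add: v_def vector_smult_assoc)
    have Fv: "F v = 1" using t by (simp add: v_def F_scale t_def)
    have "phi v = h v + Re (l v) + \<phi> 0" using \<phi>[of v] by (simp add: \<phi>_def Fv)
    then have "phi v * (norm t)\<^sup>2 = h x + (norm t)\<^sup>2 * Re (l v) + \<phi> 0 * (norm t)\<^sup>2"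
      by (simp add: x hs algebra_simps)
    also have "\<dots> = P x"
    proof -
      have "F x = t" by (simp only: t_def)
      moreover have "l x = t * l v" by (metis l(2) x)
      ultimately have "P x = h x + Re (cnj t * (t * l v + of_real (\<phi> 0) * t))"
        by (simp only: P_def G_def)
      also have "cnj t * (t * l v + of_real (\<phi> 0) * t) = of_real ((norm t)\<^sup>2) * (l v + of_real (\<phi> 0))"
        unfolding complex_norm_square by (simp add: algebra_simps)
      also have "Re \<dots> = (norm t)\<^sup>2 * Re (l v) + \<phi> 0 * (norm t)\<^sup>2" by (simp add: algebra_simps)
      finally show ?thesis by simp
    qed
    finally have "x \<in> K \<longleftrightarrow> P x \<le> Re t" using phi(2)[OF Fv, of t] by (simp only: x[symmetric])
    then show ?thesis by (simp only: t_def Re_F)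
  qed
  ultimately show ?thesis by blast
qed

text \<open>\<open>P\<close> is positive definite because \<open>K\<close> is bounded. In
  coordinates where \<open>P\<close> is the squared norm, \<open>P x \<le> x \<bullet> e\<close>
  describes a ball with \<open>0\<close> on its boundary.\<close>

lemma ellipsoid: "complex_ellipsoid K"
proof -
  obtain P where "hermitian_quadratic P" and P: "\<And>x. x \<in> K \<longleftrightarrow> P x \<le> x \<bullet> e"
    using quadric by blast
  then interpret hermitian_form P by unfold_locales
  have "P x > 0" if "x \<noteq> 0" for x
  proof (rule ccontr)
    assume "\<not> P x > 0"
    \<comment> \<open>With this sign, a direction with \<open>P \<le> 0\<close> would give a whole
      ray in \<open>K\<close>.\<close>
    define y where "y = (if x \<bullet> e \<ge> 0 then x else - x)"
    have y: "y \<noteq> 0" "P y \<le> 0" "y \<bullet> e \<ge> 0"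
      using that \<open>\<not> P x > 0\<close> by (auto simp: y_def minus)
    have in_K: "s *\<^sub>R y \<in> K" if "s \<ge> 0" for s :: real
    proof -
      have "s *\<^sub>R y = complex_of_real s *s y" unfolding vec_eq_iff vector_scaleR_component
        by (simp add: scaleR_conv_of_real)
      then have "P (s *\<^sub>R y) = s\<^sup>2 * P y" by (simp add: scale)
      also have "\<dots> \<le> 0" using y by (simp add: mult_nonneg_nonpos)
      also have "\<dots> \<le> (s *\<^sub>R y) \<bullet> e" using y that by simp
      finally show ?thesis using P by blast
    qed
    obtain M where M: "\<And>x. x \<in> K \<Longrightarrow> norm x \<le> M"
      using body'(1) compact_imp_bounded bounded_iff by metis
    have "M \<ge> 0" using M[OF zero] by simp
    then have "norm (((M + 1) / norm y) *\<^sub>R y) \<le> M" by (intro M in_K) simp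
    then show False using y(1) \<open>M \<ge> 0\<close> by simp
  qed
  from diagonalise[OF this] obtain A :: "complex ^ 'n ^ 'n" where
    A: "invertible A" "\<And>z. P (A *v z) = (norm z)\<^sup>2" by blast
  obtain w' where w': "\<And>z. hdot (A *v z) e = hdot z w'" using hdot_matrix by blast
  define w where "w = (1/2) *\<^sub>R w'"
  have AK: "A *v z \<in> K \<longleftrightarrow> z \<in> cball w (norm w)" for z
  proof -
    have "(A *v z) \<bullet> e = z \<bullet> w'" by (metis w' Re_hdot)
    then have "A *v z \<in> K \<longleftrightarrow> (norm z)\<^sup>2 \<le> 2 * (z \<bullet> w)" by (simp add: P A w_def)
    also have "\<dots> \<longleftrightarrow> (norm (z - w))\<^sup>2 \<le> (norm w)\<^sup>2"
      by (simp add: power2_norm_eq_inner inner_diff_left inner_diff_right inner_commute)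
    also have "\<dots> \<longleftrightarrow> z \<in> cball w (norm w)"
      by (simp add: dist_norm norm_minus_commute flip: abs_le_square_iff)
    finally show ?thesis .
  qed
  obtain A' where A': "A ** A' = mat 1" using A(1) by (auto simp: invertible_def)
  have K: "K = (*v) A ` cball w (norm w)"
  proof -
    have "x = A *v (A' *v x)" for x by (simp add: matrix_vector_mul_assoc A')
    then show ?thesis using AK by (metis (no_types, lifting) image_eqI image_subsetI subsetI subset_antisym)
  qed
  have "w \<noteq> 0"
  proof
    assume "w = 0"
    then have "K = {0}" by (simp add: K)
    then show False using body'(3) by simp
  qed
  define k where "k = complex_of_real (norm w)"
  have kz: "mat k *v z = norm w *\<^sub>R z" for z :: "complex ^ 'n"
  proof -
    have "(\<Sum>j\<in>UNIV. (if i = j then k else 0) * z $ j) = (\<Sum>j\<in>UNIV. if i = j then k * z $ j else 0)" for i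
      by (intro sum.cong) auto
    then show ?thesis
      unfolding vec_eq_iff vector_scaleR_component
      by (simp add: matrix_vector_mult_def mat_def scaleR_conv_of_real flip: k_def)
  qed
  have "mat k ** (mat (inverse k) :: complex ^ 'n ^ 'n) = mat 1"
  proof -
    have "k \<noteq> 0" using \<open>w \<noteq> 0\<close> by (simp add: k_def)
    have "(\<Sum>j\<in>UNIV. (if i = j then k else 0) * (if j = m then inverse k else 0))
        = (\<Sum>j\<in>UNIV. if i = j then (if j = m then 1 else 0) else 0)" for i m :: 'n
      using \<open>k \<noteq> 0\<close> by (intro sum.cong) auto
    then show ?thesis by (simp add: vec_eq_iff matrix_matrix_mult_def mat_def)
  qed
  then have "invertible (mat k :: complex ^ 'n ^ 'n)"
    by (metis invertible_def matrix_left_right_inverse)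
  then have "invertible (A ** mat k)" using A(1) by (simp add: invertible_mult)
  moreover have "K = (\<lambda>x. (A ** mat k) *v x + A *v w) ` cball 0 1"
  proof -
    have "cball w (norm w) = (\<lambda>z. norm w *\<^sub>R z + w) ` cball 0 1"
    proof -
      have "cball w (norm w) = (+) w ` cball 0 (norm w)" by (simp add: cball_translation[symmetric])
      also have "cball 0 (norm w) = (*\<^sub>R) (norm w) ` cball (0::complex ^ 'n) 1"
        using \<open>w \<noteq> 0\<close> by (simp add: cball_scale)
      finally show ?thesis by (simp add: image_image add.commute)
    qed
    then show ?thesis
      by (simp add: K image_image matrix_vector_mul_assoc[symmetric] kz matrix_vector_right_distrib)
  qed
  ultimately show ?thesis unfolding complex_ellipsoid_def by blast
qed

end

section \<open>Rotational symmetries of a plane set\<close>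

text \<open>A nonvanishing function on the disc has a continuous logarithm \<open>h\<close>. On the
  circle, \<open>h\<close> plus the angle term is a logarithm of the constant \<open>f 1\<close>,
  hence constant, since logarithms of one number are at least \<open>2 * pi\<close> apart; yet one
  turn changes it by \<open>2 * pi * k * \<i>\<close>.\<close>

lemma no_twisted_map_disc:
  fixes f :: "complex \<Rightarrow> complex"
  assumes cont: "continuous_on (cball 0 1) f" and nz: "\<And>z. z \<in> cball 0 1 \<Longrightarrow> f z \<noteq> 0"
    and twist: "\<And>z. norm z = 1 \<Longrightarrow> f z * z ^ k = f 1" and "k > 0"
  shows False
proof -
  obtain h where h: "continuous_on (cball 0 1) h" "\<And>z. z \<in> cball 0 1 \<Longrightarrow> f z = exp (h z)"
    using continuous_logarithm_on_cball[OF cont nz] by metis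
  define g where "g \<theta> = h (cis \<theta>) + \<i> * of_real (of_nat k * \<theta>)" for \<theta>
  have expg: "exp (g \<theta>) = exp (h 1)" for \<theta>
  proof -
    have "exp (g \<theta>) = f (cis \<theta>) * cis \<theta> ^ k"
      by (simp add: g_def exp_add h(2) Complex.DeMoivre cis_conv_exp[of "_ * _"])
    also have "\<dots> = exp (h 1)" using twist[of "cis \<theta>"] h(2)[of 1] by simp
    finally show ?thesis .
  qed
  have "g constant_on {0..2 * pi}"
  proof (rule continuous_discrete_range_constant)
    have "continuous_on {0..2 * pi} (\<lambda>\<theta>. h (cis \<theta>))"
      by (rule continuous_on_compose2[OF h(1)]) (auto intro!: continuous_intros)
    then show "continuous_on {0..2 * pi} g" unfolding g_def by (intro continuous_intros)
    show "\<exists>e>0. \<forall>y. y \<in> {0..2 * pi} \<and> g y \<noteq> g x \<longrightarrow> e \<le> norm (g y - g x)" for x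
    proof (intro exI[of _ "2 * pi"] conjI allI impI)
      fix y assume y: "y \<in> {0..2 * pi} \<and> g y \<noteq> g x"
      have "exp (g y) = exp (g x)" by (simp only: expg)
      then obtain n :: int where n: "g y = g x + of_real (of_int (2 * n) * pi) * \<i>"
        unfolding exp_eq by auto
      then have "n \<noteq> 0" using y by auto
      then have "1 \<le> \<bar>n\<bar>" by linarith
      then have "1 \<le> \<bar>real_of_int n\<bar>" by linarith
      moreover have "norm (g y - g x) = 2 * pi * \<bar>real_of_int n\<bar>" using n by (simp add: norm_mult abs_mult)
      ultimately show "2 * pi \<le> norm (g y - g x)" using pi_gt_zero by simp
    qed simp
  qed simp
  then have "g 0 = g (2 * pi)" unfolding constant_on_def by (metis atLeastAtMost_iff order_refl pi_ge_zero mult_nonneg_nonneg zero_le_numeral)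
  then show False using \<open>k > 0\<close> by (simp add: g_def)
qed

lemma norm_cis_diff_le: "norm (cis a - cis b) \<le> \<bar>a - b\<bar>"
proof -
  have "cis a - cis b = cis b * (exp (\<i> * of_real (a - b)) - 1)"
    by (simp add: right_diff_distrib cis_conv_exp algebra_simps flip: exp_add)
  then have "norm (cis a - cis b) = 2 * \<bar>sin ((a - b) / 2)\<bar>"
    by (simp add: norm_mult dist_exp_i_1 del: of_real_diff)
  also have "\<dots> \<le> 2 * \<bar>(a - b) / 2\<bar>" by (intro mult_left_mono abs_sin_x_le_abs_x) simp
  finally show ?thesis by simp
qed

text \<open>By Dirichlet's approximation theorem, some power of bounded exponent of each element is close to \<open>1\<close>;
  unless it equals \<open>1\<close>, its powers come close to every point of the circle.\<close>

lemma proper_closed_circle_group: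
  fixes G :: "complex set"
  assumes sub: "G \<subseteq> sphere 0 1" and "closed G" and one: "1 \<in> G"
    and mult: "\<And>u v. u \<in> G \<Longrightarrow> v \<in> G \<Longrightarrow> u * v \<in> G" and "G \<noteq> sphere 0 1"
  shows "\<exists>k>0. \<forall>u\<in>G. u ^ k = 1"
proof -
  have pow: "u ^ n \<in> G" if "u \<in> G" for u n
    by (induction n) (auto simp: one intro: mult that)
  obtain u0 where u0: "norm u0 = 1" "u0 \<notin> G" using assms by fastforce
  obtain \<epsilon> where \<epsilon>: "\<epsilon> > 0" "\<And>u. u \<in> G \<Longrightarrow> \<epsilon> \<le> dist u u0"
    using separate_point_closed[OF \<open>closed G\<close> u0(2)] by (metis dist_commute)
  obtain N :: nat where N0: "2 * pi / \<epsilon> < of_nat N" using reals_Archimedean2 by blast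
  then have N: "N > 0" "2 * pi / N < \<epsilon>"
  proof -
    have "0 < 2 * pi / \<epsilon>" using \<epsilon>(1) by simp
    then have "0 < real N" using N0 by linarith
    then show "N > 0" "2 * pi / N < \<epsilon>" using N0 \<epsilon>(1) by (auto simp: field_simps)
  qed
  \<comment> \<open>The factorial is divisible by every exponent \<open>m \<le> N\<close> that
    Dirichlet's theorem can return, so one exponent serves the whole group.\<close>
  have "u ^ fact N = 1" if u: "u \<in> G" for u
  proof -
    have nu: "norm u = 1" using u sub by auto
    define \<theta> where "\<theta> = Arg u / (2 * pi)"
    have u\<theta>: "u = cis (2 * pi * \<theta>)"
      using nu rcis_cmod_Arg[of u] by (simp add: \<theta>_def rcis_def)
    obtain h k where hk: "0 < k" "k \<le> int N" "\<bar>of_int k * \<theta> - of_int h\<bar> < 1 / N"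
      using Dirichlet_approx[OF N(1)] by blast
    define m where "m = nat k"
    have m: "0 < m" "m \<le> N" "real m = of_int k" using hk by (auto simp: m_def)
    define \<delta> where "\<delta> = of_int k * \<theta> - of_int h"
    have um: "u ^ m = cis (2 * pi * \<delta>)"
    proof -
      have "u ^ m = cis (2 * pi * (of_int k * \<theta>))"
        unfolding u\<theta> Complex.DeMoivre m(3) by (simp add: mult_ac)
      also have "of_int k * \<theta> = \<delta> + of_int h" by (simp add: \<delta>_def)
      also have "cis (2 * pi * (\<delta> + of_int h)) = cis (2 * pi * \<delta>) * cis (2 * pi * of_int h)"
        by (simp only: distrib_left cis_mult)
      also have "cis (2 * pi * of_int h) = 1" by (simp add: cis_multiple_2pi)
      finally show ?thesis by simp
    qed
    have "\<delta> = 0"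
    proof (rule ccontr)
      assume "\<delta> \<noteq> 0"
      define x where "x = Arg u0 / (2 * pi)"
      \<comment> \<open>The argument of \<open>u0\<close> in turns, shifted by a full turn to have
        the sign of \<delta>, so that a natural number of steps of size \<delta> reaches it.\<close>
      define \<theta>0 where "\<theta>0 = x + sgn \<delta>"
      have u0\<theta>: "u0 = cis (2 * pi * \<theta>0)"
      proof -
        have "2 * pi * \<theta>0 = Arg u0 + 2 * pi * sgn \<delta>" by (simp add: \<theta>0_def x_def distrib_left)
        then have "cis (2 * pi * \<theta>0) = cis (Arg u0) * cis (2 * pi * sgn \<delta>)"
          by (simp only: cis_mult)
        moreover have "cis (2 * pi * sgn \<delta>) = 1" by (simp add: sgn_if)
        ultimately show ?thesis using u0(1) rcis_cmod_Arg[of u0] by (simp add: rcis_def)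
      qed
      have "\<bar>x\<bar> \<le> 1 / 2"
        using Arg_bounded[of u0] by (simp add: x_def abs_le_iff field_simps)
      then have "\<theta>0 / \<delta> \<ge> 0"
        using \<open>\<delta> \<noteq> 0\<close> by (cases "\<delta> > 0") (auto simp: \<theta>0_def sgn_if zero_le_divide_iff)
      define j where "j = nat \<lfloor>\<theta>0 / \<delta>\<rfloor>"
      have "real j = of_int \<lfloor>\<theta>0 / \<delta>\<rfloor>" using \<open>\<theta>0 / \<delta> \<ge> 0\<close> by (simp add: j_def)
      then have "\<bar>real j - \<theta>0 / \<delta>\<bar> \<le> 1" by linarith
      then have "\<bar>\<delta>\<bar> * \<bar>real j - \<theta>0 / \<delta>\<bar> \<le> \<bar>\<delta>\<bar>" by (simp add: mult_left_le)
      then have "\<bar>real j * \<delta> - \<theta>0\<bar> \<le> \<bar>\<delta>\<bar>"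
        using \<open>\<delta> \<noteq> 0\<close> by (simp add: right_diff_distrib mult.commute flip: abs_mult)
      also have "\<dots> < 1 / N" using hk(3) by (simp add: \<delta>_def)
      finally have "2 * pi * \<bar>real j * \<delta> - \<theta>0\<bar> < 2 * pi * (1 / N)"
        by (intro mult_strict_left_mono) auto
      have "(u ^ m) ^ j = cis (2 * pi * (real j * \<delta>))"
        unfolding um Complex.DeMoivre by (simp add: mult_ac)
      then have "dist ((u ^ m) ^ j) u0 \<le> \<bar>2 * pi * (real j * \<delta>) - 2 * pi * \<theta>0\<bar>"
        using norm_cis_diff_le u0\<theta> by (metis dist_norm)
      also have "\<dots> = 2 * pi * \<bar>real j * \<delta> - \<theta>0\<bar>"
        by (simp add: abs_mult flip: right_diff_distrib)
      also have "\<dots> < \<epsilon>" using \<open>_ < 2 * pi * (1 / N)\<close> N(2) by simp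
      finally show False using \<epsilon>(2)[OF pow[OF pow[OF u]]] by (meson not_le)
    qed
    then have "u ^ m = 1" using um by simp
    moreover have "m dvd fact N" using m by (simp add: dvd_fact)
    ultimately show ?thesis by (metis dvd_def power_mult power_one)
  qed
  then show ?thesis by (intro exI[of _ "fact N"]) simp
qed

section \<open>Similarities between plane sets\<close>

text \<open>For \<open>a \<noteq> 0\<close> this says \<open>T = a S + b\<close>.\<close>

definition similar_via :: "complex set \<Rightarrow> complex \<Rightarrow> complex \<Rightarrow> complex set \<Rightarrow> bool" where
  "similar_via S a b T \<longleftrightarrow> (\<forall>t. t \<in> S \<longleftrightarrow> a * t + b \<in> T)"

lemma similar_via_iff: "similar_via S a b T \<Longrightarrow> a * t + b \<in> T \<longleftrightarrow> t \<in> S"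
  by (simp add: similar_via_def)

lemma similar_via_inverse:
  assumes "similar_via S a b T" "a \<noteq> 0"
  shows "similar_via T (inverse a) (- b / a) S"
  unfolding similar_via_def
proof
  fix t
  have "a * (inverse a * t + - b / a) + b = t" using assms(2) by (simp add: field_simps)
  then show "t \<in> T \<longleftrightarrow> inverse a * t + - b / a \<in> S" using similar_via_iff[OF assms(1)] by metis
qed

lemma similar_via_trans:
  assumes "similar_via S a b T" "similar_via T a' b' U"
  shows "similar_via S (a' * a) (a' * b + b') U"
  unfolding similar_via_def
proof
  fix t
  have "a' * (a * t + b) + b' = a' * a * t + (a' * b + b')" by (simp add: algebra_simps)
  then show "t \<in> S \<longleftrightarrow> a' * a * t + (a' * b + b') \<in> U"
    using similar_via_iff[OF assms(1), of t] similar_via_iff[OF assms(2), of "a * t + b"] by metis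
qed

text \<open>Iterating the map multiplies the difference of two points by powers of \<open>a\<close>,
  which would become unbounded.\<close>

lemma affine_self_map_bounded_norm_le_1:
  fixes S :: "complex set"
  assumes "bounded S" "x \<in> S" "y \<in> S" "x \<noteq> y" and self: "\<And>t. t \<in> S \<Longrightarrow> a * t + b \<in> S"
  shows "norm a \<le> 1"
proof (rule ccontr)
  assume "\<not> norm a \<le> 1"
  obtain M where M: "\<And>t. t \<in> S \<Longrightarrow> norm t \<le> M" using assms(1) bounded_iff by metis
  have "\<exists>x'\<in>S. \<exists>y'\<in>S. x' - y' = a ^ n * (x - y)" for n
  proof (induction n)
    case (Suc n)
    then obtain x' y' where *: "x' \<in> S" "y' \<in> S" "x' - y' = a ^ n * (x - y)" by blast
    have "(a * x' + b) - (a * y' + b) = a ^ Suc n * (x - y)"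
      using *(3) by (simp add: mult.assoc flip: right_diff_distrib)
    then show ?case using * self by blast
  qed (use assms in auto)
  then have le: "norm (a ^ n * (x - y)) \<le> M + M" for n
    using M by (metis add_mono norm_triangle_ineq4 order_trans)
  obtain n where "(M + M) / norm (x - y) < norm a ^ n"
    using real_arch_pow[of "norm a"] \<open>\<not> norm a \<le> 1\<close> by force
  then have "M + M < norm (a ^ n * (x - y))"
    using assms(4) by (simp add: norm_mult norm_power pos_divide_less_eq)
  then show False using le[of n] by linarith
qed

lemma similar_via_self_norm:
  assumes "bounded S" "x \<in> S" "y \<in> S" "x \<noteq> y" "similar_via S a b S" "a \<noteq> 0"
  shows "norm a = 1"
proof -
  have "norm a \<le> 1"
    using affine_self_map_bounded_norm_le_1[OF assms(1-4)] similar_via_iff[OF assms(5)] by blast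
  moreover have "norm (inverse a) \<le> 1"
    using affine_self_map_bounded_norm_le_1[OF assms(1-4)] similar_via_iff[OF similar_via_inverse[OF assms(5,6)]] by blast
  ultimately show ?thesis using assms(6) by (simp add: norm_inverse inverse_le_1_iff)
qed

text \<open>The half-turn gives a centre \<open>c\<close>. Every other rotational symmetry must fix
  \<open>c\<close>, as otherwise it would generate a translation preserving the bounded set. A
  convex set invariant under all rotations about \<open>c\<close> is the disc reaching its farthest
  point.\<close>

lemma rotation_symmetric_imp_disc:
  fixes S :: "complex set"
  assumes S: "compact S" "convex S" "S \<noteq> {}"
    and rot: "\<And>u. norm u = 1 \<Longrightarrow> \<exists>b. similar_via S u b S"
  shows "\<exists>c r. S = cball c r"
proof -
  obtain b0 where "similar_via S (- 1) b0 S" using rot[of "- 1"] by auto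
  then have refl: "b0 - t \<in> S \<longleftrightarrow> t \<in> S" for t using similar_via_iff[of S "-1" b0 S t] by simp
  define c where "c = b0 / 2"
  obtain M where M: "\<And>t. t \<in> S \<Longrightarrow> norm t \<le> M"
    using S(1) compact_imp_bounded bounded_iff by metis
  have inv: "c + u * x \<in> S \<longleftrightarrow> c + x \<in> S" if u: "norm u = 1" for u x
  proof -
    obtain b where b: "similar_via S u b S" using rot u by blast
    have "u \<noteq> 0" using u by auto
    \<comment> \<open>Translation vector of the commutator of the rotation with the half-turn; it
      vanishes exactly when the rotation fixes \<open>c\<close>.\<close>
    define d where "d = 2 * (c - (u * c + b))"
    have shift: "y + d \<in> S" if "y \<in> S" for y
    proof -
      have "u * ((y - b) / u) + b = y" using \<open>u \<noteq> 0\<close> by simp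
      then have "(y - b) / u \<in> S" using that similar_via_iff[OF b] by metis
      then have "u * (b0 - (y - b) / u) + b \<in> S" using similar_via_iff[OF b] refl by blast
      then have "b0 - (u * (b0 - (y - b) / u) + b) \<in> S" using refl by blast
      moreover have "b0 - (u * (b0 - (y - b) / u) + b) = y + d"
      proof -
        have "u * (b0 - (y - b) / u) = u * b0 - (y - b)" using \<open>u \<noteq> 0\<close> by (subst right_diff_distrib) simp
        then show ?thesis by (simp add: d_def c_def algebra_simps)
      qed
      ultimately show ?thesis by simp
    qed
    have "d = 0"
    proof (rule ccontr)
      assume "d \<noteq> 0"
      obtain y where "y \<in> S" using S(3) by blast
      have "y + of_nat n * d \<in> S" for n
      proof (induction n)
        case (Suc n)
        then show ?case using shift[OF Suc] by (simp add: algebra_simps)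
      qed (use \<open>y \<in> S\<close> in simp)
      then have le: "norm (of_nat n * d) \<le> M + norm y" for n
        using M norm_triangle_ineq4[of "y + of_nat n * d" y]
        by (metis add_diff_cancel_left' add_right_mono order_trans)
      obtain n :: nat where "(M + norm y) / norm d < n" using reals_Archimedean2 by blast
      then have "M + norm y < norm (of_nat n * d)"
        using \<open>d \<noteq> 0\<close> by (simp add: norm_mult pos_divide_less_eq)
      then show False using le[of n] by linarith
    qed
    then have "c - (u * c + b) = 0" unfolding d_def by (metis mult_eq_0_iff zero_neq_numeral)
    then have "u * c + b = c" by (metis eq_iff_diff_eq_0)
    then have "u * (c + x) + b = c + u * x" by (simp add: algebra_simps)
    then show ?thesis using similar_via_iff[OF b] by metis
  qed
  obtain y0 where y0: "y0 \<in> S" "\<And>y. y \<in> S \<Longrightarrow> dist c y \<le> dist c y0"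
    using distance_attains_sup[OF S(1,3)] by blast
  have "S = cball c (dist c y0)"
  proof
    show "S \<subseteq> cball c (dist c y0)" using y0(2) by auto
    show "cball c (dist c y0) \<subseteq> S"
    proof
      fix y assume y: "y \<in> cball c (dist c y0)"
      define r where "r = dist c y0"
      define x0 where "x0 = y0 - c"
      have x0: "norm x0 = r" "c + x0 \<in> S" using y0(1) by (auto simp: x0_def r_def dist_norm norm_minus_commute)
      have ny: "norm (y - c) \<le> r" using y by (simp add: r_def dist_norm norm_minus_commute)
      show "y \<in> S"
      proof (cases "r = 0")
        case True
        then show ?thesis using ny x0 by simp
      next
        case False
        then have r: "r > 0" using x0(1) norm_ge_zero[of x0] by linarith
        \<comment> \<open>The rotation turning \<open>x0\<close> into the direction of
          \<open>y - c\<close>; then \<open>y\<close> lies on the diameter between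
          \<open>c + u * x0\<close> and \<open>c - u * x0\<close>.\<close>
        define u where "u = (if y = c then 1 else (y - c) * of_real r / (of_real (norm (y - c)) * x0))"
        have u: "norm u = 1" using r x0 by (auto simp: u_def norm_mult norm_divide)
        define s where "s = norm (y - c) / r"
        have s: "0 \<le> s" "s \<le> 1" using ny r by (auto simp: s_def)
        have yc: "y - c = of_real s * (u * x0)"
          using r x0 by (auto simp: u_def s_def field_simps)
        have "c + u * x0 \<in> S" "c + (- u) * x0 \<in> S" using inv[of u x0] inv[of "- u" x0] u x0 by auto
        then have "(1 - (1 - s) / 2) *\<^sub>R (c + u * x0) + ((1 - s) / 2) *\<^sub>R (c + (- u) * x0) \<in> S"
          using s by (intro convexD_alt[OF S(2)]) auto
        also have "(1 - (1 - s) / 2) *\<^sub>R (c + u * x0) + ((1 - s) / 2) *\<^sub>R (c + (- u) * x0) = c + of_real s * (u * x0)"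
          by (simp add: scaleR_conv_of_real field_simps)
        finally show ?thesis using yc by (metis add_diff_cancel_left' diff_add_cancel add.commute)
      qed
    qed
  qed
  then show ?thesis by blast
qed

lemma similar_via_cball:
  assumes "similar_via (cball c r) a b T" "a \<noteq> 0"
  shows "T = cball (a * c + b) (norm a * r)"
proof -
  have "t \<in> T \<longleftrightarrow> t \<in> cball (a * c + b) (norm a * r)" for t
  proof -
    have "t \<in> T \<longleftrightarrow> norm (c - (inverse a * t + - b / a)) \<le> r"
      using similar_via_iff[OF similar_via_inverse[OF assms], of t] by (simp add: dist_norm)
    also have "\<dots> \<longleftrightarrow> norm a * norm (c - (inverse a * t + - b / a)) \<le> norm a * r"
      using assms(2) by simp
    also have "norm a * norm (c - (inverse a * t + - b / a)) = norm (a * c + b - t)"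
      unfolding norm_mult[symmetric] using assms(2)
      by (simp add: right_diff_distrib distrib_left diff_diff_eq2 flip: mult.assoc)
    finally show ?thesis by (simp add: dist_norm)
  qed
  then show ?thesis by blast
qed

section \<open>Similar line sections\<close>

lemma nontrivial_section_line:
  assumes "v \<noteq> 0"
  shows "nontrivial_section K {p + t *s v | t. True} \<longleftrightarrow> (\<exists>s t. s \<noteq> t \<and> s \<in> line_section K p v \<and> t \<in> line_section K p v)"
proof
  assume "nontrivial_section K {p + t *s v | t. True}"
  then obtain s t where "p + s *s v \<in> K" "p + t *s v \<in> K" "p + s *s v \<noteq> p + t *s v"
    unfolding nontrivial_section_def by blast
  then show "\<exists>s t. s \<noteq> t \<and> s \<in> line_section K p v \<and> t \<in> line_section K p v"
    by (metis line_section_def mem_Collect_eq)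
next
  assume "\<exists>s t. s \<noteq> t \<and> s \<in> line_section K p v \<and> t \<in> line_section K p v"
  then obtain s t where st: "s \<noteq> t" "p + s *s v \<in> K" "p + t *s v \<in> K"
    by (auto simp: line_section_def)
  have "p + s *s v \<noteq> p + t *s v" using st(1) assms by simp
  then show "nontrivial_section K {p + t *s v | t. True}"
    unfolding nontrivial_section_def using st by blast
qed

text \<open>In line parameters an affine map is determined by its values at \<open>0\<close> and
  \<open>1\<close>, so it has the form \<open>a * t + b\<close>; injectivity gives
  \<open>a \<noteq> 0\<close>.\<close>

lemma affine_bijection_imp_similar:
  assumes v: "v \<noteq> 0" "w \<noteq> 0"
    and bij: "bij_betw \<phi> {p + t *s v | t. True} {q + t *s w | t. True}"
    and aff: "complex_affine_on {p + t *s v | t. True} \<phi>"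
    and im: "\<phi> ` ({p + t *s v | t. True} \<inter> K) = {q + t *s w | t. True} \<inter> K"
  shows "\<exists>a b. a \<noteq> 0 \<and> similar_via (line_section K p v) a b (line_section K q w)"
proof -
  define L where "L = {p + t *s v | t. True}"
  have L: "p + t *s v \<in> L" for t by (auto simp: L_def)
  have inj: "inj_on \<phi> L" using bij by (simp add: L_def bij_betw_def)
  have "\<phi> x \<in> {q + t *s w | t. True}" if "x \<in> L" for x
    using bij that unfolding L_def bij_betw_def by blast
  then have ex: "\<exists>t. \<phi> x = q + t *s w" if "x \<in> L" for x using that by blast
  obtain b where b: "\<phi> (p + 0 *s v) = q + b *s w" using ex L by blast
  obtain c where c: "\<phi> (p + 1 *s v) = q + c *s w" using ex L by blast
  define a where "a = c - b"
  have \<phi>: "\<phi> (p + t *s v) = q + (a * t + b) *s w" for t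
  proof -
    have "p + t *s v = (1 - t) *s (p + 0 *s v) + t *s (p + 1 *s v)"
      by (simp add: vec_eq_iff algebra_simps)
    then have "\<phi> (p + t *s v) = (1 - t) *s \<phi> (p + 0 *s v) + t *s \<phi> (p + 1 *s v)"
      using aff L unfolding complex_affine_on_def L_def[symmetric] by metis
    also have "\<dots> = q + (a * t + b) *s w"
      unfolding b c a_def by (simp add: vec_eq_iff algebra_simps)
    finally show ?thesis .
  qed
  have "a \<noteq> 0"
  proof
    assume "a = 0"
    then have "\<phi> (p + 1 *s v) = \<phi> (p + 0 *s v)" using \<phi>[of 0] \<phi>[of 1] by simp
    then have "p + 1 *s v = p + 0 *s v" using inj L by (metis inj_onD)
    then show False using v by simp
  qed
  moreover have "similar_via (line_section K p v) a b (line_section K q w)"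
    unfolding similar_via_def line_section_def mem_Collect_eq
  proof
    fix t
    have "p + t *s v \<in> K \<longleftrightarrow> \<phi> (p + t *s v) \<in> \<phi> ` (L \<inter> K)"
      using inj L by (metis IntI Int_iff Int_lower1 inj_on_image_mem_iff)
    also have "\<dots> \<longleftrightarrow> \<phi> (p + t *s v) \<in> {q + t *s w | t. True} \<inter> K"
      using im by (simp only: L_def)
    also have "\<dots> \<longleftrightarrow> q + (a * t + b) *s w \<in> K" unfolding \<phi> by blast
    finally show "p + t *s v \<in> K \<longleftrightarrow> q + (a * t + b) *s w \<in> K" .
  qed
  ultimately show ?thesis by blast
qed

lemma similar_imp_affine_bijection:
  assumes v: "v \<noteq> 0" "w \<noteq> 0" and a: "a \<noteq> 0"
    and sim: "similar_via (line_section K p v) a b (line_section K q w)"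
  shows "\<exists>\<phi>. bij_betw \<phi> {p + t *s v | t. True} {q + t *s w | t. True}
    \<and> complex_affine_on {p + t *s v | t. True} \<phi>
    \<and> \<phi> ` ({p + t *s v | t. True} \<inter> K) = {q + t *s w | t. True} \<inter> K"
proof -
  obtain i where i: "v $ i \<noteq> 0" using v by (auto simp: vec_eq_iff)
  \<comment> \<open>A nonzero coordinate of \<open>v\<close> reads off the parameter of a point on
    the first line.\<close>
  define \<phi> where "\<phi> x = q + (a * ((x - p) $ i / v $ i) + b) *s w" for x
  have \<phi>: "\<phi> (p + t *s v) = q + (a * t + b) *s w" for t using i by (simp add: \<phi>_def)
  have inj: "s = t" if "q + s *s w = q + t *s w" for s t using that v by simp
  have surj: "\<exists>s. t = a * s + b" for t using a by (intro exI[of _ "(t - b) / a"]) simp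
  have "bij_betw \<phi> {p + t *s v | t. True} {q + t *s w | t. True}"
  proof (rule bij_betw_imageI)
    show "inj_on \<phi> {p + t *s v | t. True}"
      using a v by (auto simp: inj_on_def \<phi>)
    show "\<phi> ` {p + t *s v | t. True} = {q + t *s w | t. True}"
    proof
      show "\<phi> ` {p + t *s v | t. True} \<subseteq> {q + t *s w | t. True}" using \<phi> by blast
      show "{q + t *s w | t. True} \<subseteq> \<phi> ` {p + t *s v | t. True}"
      proof
        fix x assume "x \<in> {q + t *s w | t. True}"
        then obtain t where "x = q + t *s w" by blast
        moreover obtain s where "t = a * s + b" using surj by blast
        ultimately have "x = \<phi> (p + s *s v)" by (simp only: \<phi>)
        then show "x \<in> \<phi> ` {p + t *s v | t. True}" by blast
      qed
    qed
  qed
  moreover have "complex_affine_on {p + t *s v | t. True} \<phi>"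
    unfolding complex_affine_on_def
  proof (intro ballI allI)
    fix x y t assume "x \<in> {p + t *s v | t. True}" "y \<in> {p + t *s v | t. True}"
    then obtain r s where xy: "x = p + r *s v" "y = p + s *s v" by blast
    have "(1 - t) *s x + t *s y = p + ((1 - t) * r + t * s) *s v"
      by (simp add: xy vec_eq_iff algebra_simps)
    then have "\<phi> ((1 - t) *s x + t *s y) = q + (a * ((1 - t) * r + t * s) + b) *s w"
      by (simp only: \<phi>)
    also have "\<dots> = (1 - t) *s \<phi> x + t *s \<phi> y"
      unfolding xy \<phi> by (simp add: vec_eq_iff algebra_simps)
    finally show "\<phi> ((1 - t) *s x + t *s y) = (1 - t) *s \<phi> x + t *s \<phi> y" .
  qed
  moreover have "\<phi> ` ({p + t *s v | t. True} \<inter> K) = {q + t *s w | t. True} \<inter> K"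
  proof -
    have iff: "p + t *s v \<in> K \<longleftrightarrow> \<phi> (p + t *s v) \<in> K" for t
      using similar_via_iff[OF sim, of t] unfolding line_section_def \<phi> by blast
    define L where "L = {p + t *s v | t. True}"
    have "x \<in> K \<longleftrightarrow> \<phi> x \<in> K" if "x \<in> L" for x using that iff unfolding L_def by blast
    then have "\<phi> ` (L \<inter> K) = \<phi> ` L \<inter> K" by blast
    then show ?thesis using calculation(1) by (simp only: L_def bij_betw_def)
  qed
  ultimately show ?thesis by blast
qed

section \<open>Limits of sections through an interior point\<close>

lemma tendsto_smult_vec:
  fixes f :: "'a \<Rightarrow> complex" and g :: "'a \<Rightarrow> complex ^ 'n"
  assumes "(f \<longlongrightarrow> a) F" "(g \<longlongrightarrow> b) F"
  shows "((\<lambda>x. f x *s g x) \<longlongrightarrow> a *s b) F"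
  by (rule vec_tendstoI) (auto intro!: tendsto_intros assms)

context
  fixes K :: "(complex ^ 'n) set" and p :: "complex ^ 'n"
  assumes body: "convex_body K" and p: "p \<in> interior K"
begin

lemma line_section_compact_convex:
  assumes "v \<noteq> 0"
  shows "compact (line_section K q v)" "convex (line_section K q v)"
proof -
  obtain M where M: "\<And>x. x \<in> K \<Longrightarrow> norm x \<le> M"
    using body unfolding convex_body_def using compact_imp_bounded bounded_iff by metis
  have "norm t \<le> (M + norm q) / norm v" if "t \<in> line_section K q v" for t
  proof -
    have "norm (q + t *s v) \<le> M" using that M by (simp add: line_section_def)
    then have "norm (t *s v) \<le> M + norm q"
      using norm_triangle_ineq4[of "q + t *s v" q] by simp
    then show ?thesis using assms by (simp add: norm_smult_vec field_simps)
  qed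
  then have "bounded (line_section K q v)" unfolding bounded_iff by blast
  moreover have "closed (line_section K q v)"
    unfolding closed_sequential_limits
  proof (intro allI impI, elim conjE)
    fix x l assume x: "\<forall>n. x n \<in> line_section K q v" "x \<longlonglongrightarrow> l"
    have "closed K" using body by (simp add: convex_body_def compact_imp_closed)
    moreover have "q + x n *s v \<in> K" for n using x by (simp add: line_section_def)
    moreover have "(\<lambda>n. q + x n *s v) \<longlonglongrightarrow> q + l *s v"
      by (intro tendsto_intros tendsto_smult_vec x)
    ultimately have "q + l *s v \<in> K" by (rule closed_sequentially)
    then show "l \<in> line_section K q v" by (simp add: line_section_def)
  qed
  ultimately show "compact (line_section K q v)" by (simp add: compact_eq_bounded_closed)
  show "convex (line_section K q v)"
  proof (rule convexI)
    fix s t and a b :: real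
    assume st: "s \<in> line_section K q v" "t \<in> line_section K q v" "0 \<le> a" "0 \<le> b" "a + b = 1"
    have "a *\<^sub>R (q + s *s v) + b *\<^sub>R (q + t *s v) \<in> K"
      using st body by (intro convexD) (auto simp: convex_body_def line_section_def)
    also have "a *\<^sub>R (q + s *s v) + b *\<^sub>R (q + t *s v) = (a + b) *\<^sub>R q + (a *\<^sub>R s + b *\<^sub>R t) *s v"
      by (simp add: vec_eq_iff algebra_simps)
    finally show "a *\<^sub>R s + b *\<^sub>R t \<in> line_section K q v" using st(5) by (simp add: line_section_def)
  qed
qed

lemma line_section_interior_point: "\<exists>t. t \<noteq> 0 \<and> p + t *s v \<in> interior K"
proof -
  obtain \<epsilon> where \<epsilon>: "\<epsilon> > 0" "ball p \<epsilon> \<subseteq> interior K"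
    using p open_interior open_contains_ball by blast
  define r where "r = \<epsilon> / 2 / (norm v + 1)"
  have n: "norm v + 1 > 0" using norm_ge_zero[of v] by linarith
  have r: "r > 0" using \<epsilon>(1) n by (simp add: r_def)
  have "norm (complex_of_real r *s v) = \<epsilon> / 2 * (norm v / (norm v + 1))"
    using r by (simp add: norm_smult_vec) (simp add: r_def)
  also have "\<dots> \<le> \<epsilon> / 2 * 1"
    using \<epsilon>(1) by (intro mult_left_mono) (use n in auto)
  finally have "p + complex_of_real r *s v \<in> ball p \<epsilon>"
    using \<epsilon>(1) by (simp add: dist_norm)
  then show ?thesis using \<epsilon> r by (intro exI[of _ "complex_of_real r"]) auto
qed

text \<open>The shape of the section through an interior point depends continuously on the direction.\<close>

lemma section_limit:
  fixes V :: "nat \<Rightarrow> complex ^ 'n"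
  assumes V: "V \<longlonglongrightarrow> v" and a: "\<alpha> \<longlonglongrightarrow> a" and b: "\<beta> \<longlonglongrightarrow> b" and "\<And>n. \<alpha> n \<noteq> 0"
    and S: "compact S" and sim: "\<And>n. similar_via S (\<alpha> n) (\<beta> n) (line_section K p (V n))"
  shows "a \<noteq> 0 \<and> similar_via S a b (line_section K p v)"
proof -
  have K: "closed K" "convex K" using body by (auto simp: convex_body_def compact_imp_closed)
  \<comment> \<open>An interior point on the limit line keeps its parameter in the sections of all
    nearby directions, because the interior is open.\<close>
  have pre: "\<forall>\<^sub>F n in sequentially. (t - \<beta> n) / \<alpha> n \<in> S" if t: "p + t *s v \<in> interior K" for t
  proof -
    have "(\<lambda>n. p + t *s V n) \<longlonglongrightarrow> p + t *s v"
      by (intro tendsto_intros tendsto_smult_vec V)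
    then have "\<forall>\<^sub>F n in sequentially. p + t *s V n \<in> interior K"
      using t by (rule topological_tendstoD[OF _ open_interior])
    then show ?thesis
    proof eventually_elim
      case (elim n)
      have "\<alpha> n * ((t - \<beta> n) / \<alpha> n) + \<beta> n = t" using assms(4) by simp
      moreover have "t \<in> line_section K p (V n)"
        using elim interior_subset by (auto simp: line_section_def)
      ultimately show ?case using similar_via_iff[OF sim[of n]] by metis
    qed
  qed
  obtain M where M: "\<And>s. s \<in> S \<Longrightarrow> norm s \<le> M"
    using S compact_imp_bounded bounded_iff by metis
  \<comment> \<open>A vanishing limit factor would collapse all interior parameters of the limit
    section to \<open>b\<close>, but \<open>0\<close> and some \<open>t \<noteq> 0\<close> are both
    interior.\<close>
  have "a \<noteq> 0"
  proof
    assume "a = 0"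
    have "t = b" if t: "p + t *s v \<in> interior K" for t
    proof -
      have "\<forall>\<^sub>F n in sequentially. norm (t - \<beta> n) \<le> M * norm (\<alpha> n)"
        using pre[OF t]
      proof eventually_elim
        case (elim n)
        then have "norm ((t - \<beta> n) / \<alpha> n) \<le> M" by (rule M)
        then show ?case using assms(4)[of n] by (simp add: norm_divide field_simps)
      qed
      moreover have "(\<lambda>n. norm (t - \<beta> n)) \<longlonglongrightarrow> norm (t - b)" by (intro tendsto_intros b)
      moreover have "(\<lambda>n. M * norm (\<alpha> n)) \<longlonglongrightarrow> M * norm a" by (intro tendsto_intros a)
      ultimately have "norm (t - b) \<le> M * norm a" by (intro tendsto_le) auto
      then show ?thesis using \<open>a = 0\<close> by simp
    qed
    moreover obtain t where "t \<noteq> 0" "p + t *s v \<in> interior K" using line_section_interior_point by blast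
    ultimately show False using p by (metis add.right_neutral vector_smult_lzero)
  qed
  have int: "(t - b) / a \<in> S" if t: "p + t *s v \<in> interior K" for t
  proof -
    have "(\<lambda>n. (t - \<beta> n) / \<alpha> n) \<longlonglongrightarrow> (t - b) / a" using \<open>a \<noteq> 0\<close> by (intro tendsto_intros a b)
    then show ?thesis
      using Lim_in_closed_set[OF compact_imp_closed[OF S] pre[OF t]] by simp
  qed
  have "s \<in> S \<longleftrightarrow> p + (a * s + b) *s v \<in> K" for s
  proof
    assume "s \<in> S"
    then have 1: "p + (\<alpha> n * s + \<beta> n) *s V n \<in> K" for n
      using similar_via_iff[OF sim[of n]] by (auto simp: line_section_def)
    have "(\<lambda>n. p + (\<alpha> n * s + \<beta> n) *s V n) \<longlonglongrightarrow> p + (a * s + b) *s v"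
      by (intro tendsto_intros tendsto_smult_vec a b V)
    then show "p + (a * s + b) *s v \<in> K" by (rule closed_sequentially[OF K(1) 1])
  next
    assume sK: "p + (a * s + b) *s v \<in> K"
    define t where "t = a * s + b"
    \<comment> \<open>Points of \<open>K\<close> on the limit line need not be interior; contracting
      them towards \<open>p\<close> by these factors makes them so, and closedness of
      \<open>S\<close> recovers the limit.\<close>
    define e where "e n = 1 / (real n + 1)" for n
    have e: "0 < e n" "e n \<le> 1" for n by (auto simp: e_def)
    have 1: "(of_real (1 - e n) * t - b) / a \<in> S" for n
    proof (rule int)
      have "(p + t *s v) - e n *\<^sub>R ((p + t *s v) - p) \<in> interior K"
        using sK e p K(2) by (intro mem_interior_convex_shrink) (auto simp: t_def)
      also have "(p + t *s v) - e n *\<^sub>R ((p + t *s v) - p) = p + (of_real (1 - e n) * t) *s v"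
        unfolding vec_eq_iff vector_scaleR_component vector_minus_component vector_add_component
        by (simp add: scaleR_conv_of_real algebra_simps)
      finally show "p + (of_real (1 - e n) * t) *s v \<in> interior K" .
    qed
    have "e \<longlonglongrightarrow> 0" unfolding e_def using LIMSEQ_inverse_real_of_nat by (simp add: inverse_eq_divide add.commute)
    then have "(\<lambda>n. (of_real (1 - e n) * t - b) / a) \<longlonglongrightarrow> (of_real (1 - 0) * t - b) / a"
      using \<open>a \<noteq> 0\<close> by (intro tendsto_intros)
    then have "(of_real (1 - 0) * t - b) / a \<in> S"
      by (rule closed_sequentially[OF compact_imp_closed[OF S] 1])
    then show "s \<in> S" using \<open>a \<noteq> 0\<close> by (simp add: t_def)
  qed
  then show ?thesis using \<open>a \<noteq> 0\<close> by (simp add: similar_via_def line_section_def)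
qed

end

text \<open>The translation parts are bounded because each symmetry keeps \<open>s0\<close> in the
  bounded set, so a subsequence of the symmetries converges.\<close>

lemma symmetry_group_closed:
  fixes S :: "complex set"
  assumes S: "compact S" "s0 \<in> S"
  shows "closed {u. norm u = 1 \<and> (\<exists>b. similar_via S u b S)}"
  unfolding closed_sequential_limits
proof (intro allI impI, elim conjE)
  fix x l assume x: "\<forall>n. x n \<in> {u. norm u = 1 \<and> (\<exists>b. similar_via S u b S)}" "x \<longlonglongrightarrow> l"
  then obtain \<beta> where \<beta>: "\<And>n. norm (x n) = 1" "\<And>n. similar_via S (x n) (\<beta> n) S"
    unfolding mem_Collect_eq by metis
  have l: "norm l = 1"
    using tendsto_norm[OF x(2)] \<beta>(1) by (simp add: LIMSEQ_const_iff)
  then have "l \<noteq> 0" by auto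
  obtain M where M: "\<And>s. s \<in> S \<Longrightarrow> norm s \<le> M"
    using S compact_imp_bounded bounded_iff by metis
  have "norm (\<beta> n) \<le> M + norm s0" for n
  proof -
    have "norm (x n * s0 + \<beta> n) \<le> M" using M similar_via_iff[OF \<beta>(2)] S(2) by blast
    then show ?thesis
      using norm_triangle_ineq4[of "x n * s0 + \<beta> n" "x n * s0"] \<beta>(1)[of n] by (simp add: norm_mult)
  qed
  then have "bounded (range \<beta>)" unfolding bounded_iff by blast
  then obtain b r where r: "strict_mono r" "(\<beta> \<circ> r) \<longlonglongrightarrow> b" using bounded_imp_convergent_subsequence by blast
  have xr: "(\<lambda>n. x (r n)) \<longlonglongrightarrow> l" and br: "(\<lambda>n. \<beta> (r n)) \<longlonglongrightarrow> b"
    using LIMSEQ_subseq_LIMSEQ[OF x(2) r(1)] r(2) by (simp_all add: o_def)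
  have cl: "closed S" using S(1) by (rule compact_imp_closed)
  have "t \<in> S \<longleftrightarrow> l * t + b \<in> S" for t
  proof
    assume t: "t \<in> S"
    have 1: "x (r n) * t + \<beta> (r n) \<in> S" for n using t similar_via_iff[OF \<beta>(2)] by blast
    have "(\<lambda>n. x (r n) * t + \<beta> (r n)) \<longlonglongrightarrow> l * t + b" by (intro tendsto_intros xr br)
    then show "l * t + b \<in> S" by (rule closed_sequentially[OF cl 1])
  next
    assume t: "l * t + b \<in> S"
    have 1: "(l * t + b - \<beta> (r n)) / x (r n) \<in> S" for n
    proof -
      have "x (r n) * ((l * t + b - \<beta> (r n)) / x (r n)) + \<beta> (r n) = l * t + b"
        using \<beta>(1)[of "r n"] by auto
      then show ?thesis using t similar_via_iff[OF \<beta>(2)[of "r n"]] by metis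
    qed
    have "(\<lambda>n. (l * t + b - \<beta> (r n)) / x (r n)) \<longlonglongrightarrow> (l * t + b - b) / l"
      using \<open>l \<noteq> 0\<close> by (intro tendsto_intros xr br)
    then have "(l * t + b - b) / l \<in> S" by (rule closed_sequentially[OF cl 1])
    then show "t \<in> S" using \<open>l \<noteq> 0\<close> by simp
  qed
  then show "l \<in> {u. norm u = 1 \<and> (\<exists>b. similar_via S u b S)}"
    using l by (auto simp: similar_via_def)
qed

text \<open>If the common shape had only finitely many rotational symmetries, say with orders dividing \<open>k\<close>, then
  \<open>(a / \<bar>a\<bar>)\<^sup>k\<close>, where \<open>a\<close> rotates and scales a model onto the section in direction \<open>v\<close>, would be a continuous nonvanishing function
  of \<open>v\<close>, homogeneous of degree \<open>-k\<close> under the circle action. Such a function does not exist, because the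
  orbits of the circle are contractible among nonzero directions.\<close>

lemma sections_similar_imp_discs:
  fixes K :: "(complex ^ 'n) set"
  assumes dim: "CARD('n) \<ge> 2" and body: "convex_body K"
    and sim: "\<And>p v q w s t s' t'. v \<noteq> 0 \<Longrightarrow> w \<noteq> 0 \<Longrightarrow> s \<noteq> t \<Longrightarrow> s \<in> line_section K p v \<Longrightarrow> t \<in> line_section K p v
      \<Longrightarrow> s' \<noteq> t' \<Longrightarrow> s' \<in> line_section K q w \<Longrightarrow> t' \<in> line_section K q w
      \<Longrightarrow> \<exists>a b. a \<noteq> 0 \<and> similar_via (line_section K p v) a b (line_section K q w)"
    and "w \<noteq> 0"
  shows "\<exists>c r. line_section K q w = cball c r"
proof -
  obtain p where p: "p \<in> interior K" using body by (auto simp: convex_body_def)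
  obtain i j :: 'n where ij: "i \<noteq> j"
    using dim by (metis (full_types) UNIV_I card_2_iff' card_le_Suc0_iff_eq finite numeral_2_eq_2 not_less_eq_eq)
  \<comment> \<open>A disc of nonzero directions whose boundary is the circle orbit of
    \<open>V 1\<close>: at \<open>norm z = 1\<close> the second coordinate vanishes and
    \<open>V z = z *s V 1\<close>.\<close>
  define V :: "complex \<Rightarrow> complex ^ 'n" where "V z = z *s axis i 1 + of_real (1 - norm z) *s axis j 1" for z
  have Vi: "V z $ i = z" and Vj: "V z $ j = of_real (1 - norm z)" for z
    using ij by (simp_all add: V_def axis_def)
  have V0: "V z \<noteq> 0" for z
  proof
    assume "V z = 0"
    then have "z = 0" "complex_of_real (1 - norm z) = 0" using Vi[of z] Vj[of z] by (simp_all only: zero_index)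
    then show False by simp
  qed
  have nontriv: "\<exists>t. t \<noteq> 0 \<and> t \<in> line_section K p v" and zero: "0 \<in> line_section K p v" for v
    using line_section_interior_point[OF body p, of v] p interior_subset[of K]
    by (auto simp: line_section_def)
  define S where "S = line_section K p (V 1)"
  have S: "compact S" "convex S" unfolding S_def using line_section_compact_convex[OF body p V0] by auto
  have S0: "0 \<in> S" unfolding S_def by (rule zero)
  obtain \<eta> where \<eta>: "\<eta> \<noteq> 0" "\<eta> \<in> S" using nontriv unfolding S_def by blast
  define G where "G = {u. norm u = 1 \<and> (\<exists>b. similar_via S u b S)}"
  have "G = sphere 0 1"
  proof (rule ccontr)
    assume "G \<noteq> sphere 0 1"
    have "\<exists>k>0. \<forall>u\<in>G. u ^ k = 1"
    proof (rule proper_closed_circle_group)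
      show "G \<subseteq> sphere 0 1" by (auto simp: G_def)
      show "closed G" unfolding G_def by (rule symmetry_group_closed[OF S(1) S0])
      have "similar_via S 1 0 S" by (simp add: similar_via_def)
      then show "1 \<in> G" unfolding G_def by auto
      show "u * v \<in> G" if "u \<in> G" "v \<in> G" for u v
        using that similar_via_trans[of S v _ S u _ S] unfolding G_def by (auto simp: norm_mult)
    qed fact
    then obtain k where k: "k > 0" "\<And>u. u \<in> G \<Longrightarrow> u ^ k = 1" by blast
    \<comment> \<open>Two similarities of \<open>S\<close> onto the same set differ by a symmetry of
      \<open>S\<close>, whose rotation lies in \<open>G\<close> and is killed by the power
      \<open>k\<close>.\<close>
    have well: "(a / norm a) ^ k = (a' / norm a') ^ k"
      if "similar_via S a b T" "a \<noteq> 0" "similar_via S a' b' T" "a' \<noteq> 0" for a b a' b' T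
    proof -
      have s: "similar_via S (inverse a' * a) (inverse a' * b + - b' / a') S"
        by (rule similar_via_trans[OF that(1) similar_via_inverse[OF that(3,4)]])
      then have n: "norm (inverse a' * a) = 1"
        using similar_via_self_norm[OF compact_imp_bounded[OF S(1)] \<eta>(2) S0 \<eta>(1) s] that by simp
      then have "inverse a' * a \<in> G" using s unfolding G_def by blast
      then have "(inverse a' * a) ^ k = 1" by (rule k(2))
      then have "a ^ k = a' ^ k" using that by (simp add: power_mult_distrib power_inverse field_simps)
      moreover have "norm a = norm a'" using n that unfolding norm_mult norm_inverse by (simp add: field_simps)
      ultimately show ?thesis by (simp add: power_divide)
    qed
    have "\<exists>a b. a \<noteq> 0 \<and> similar_via S a b (line_section K p (V z))" for z
      using sim[OF V0 V0, of _ _ _ 1] nontriv[of "V 1"] zero[of "V 1"] nontriv[of "V z"] zero[of "V z"]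
      unfolding S_def by metis
    then obtain a b where ab: "\<And>z. a z \<noteq> 0" "\<And>z. similar_via S (a z) (b z) (line_section K p (V z))"
      by metis
    define f where "f z = (a z / norm (a z)) ^ k" for z
    have f: "f z = (a' / norm a') ^ k" if "similar_via S a' b' (line_section K p (V z))" "a' \<noteq> 0" for z a' b'
      unfolding f_def using well[OF ab(2) ab(1) that] .
    have nf: "norm (f z) = 1" for z
      using ab(1)[of z] by (simp add: f_def norm_power norm_divide)
    obtain M where M: "\<And>x. x \<in> K \<Longrightarrow> norm x \<le> M"
      using body unfolding convex_body_def using compact_imp_bounded bounded_iff by metis
    \<comment> \<open>The two nonzero coordinates of \<open>t *s V z\<close> have norms adding up to
      \<open>norm t\<close>, each bounded by \<open>M + norm p\<close>; this bounds all the sections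
      uniformly.\<close>
    define R where "R = 2 * (M + norm p)"
    have R: "norm t \<le> R" if t: "t \<in> line_section K p (V z)" "z \<in> cball 0 1" for t z
    proof -
      have "norm (p + t *s V z) \<le> M" using t M by (simp add: line_section_def)
      then have le: "norm (t *s V z) \<le> M + norm p"
        using norm_triangle_ineq4[of "p + t *s V z" p] by simp
      have "norm (t * z) \<le> M + norm p" "norm (t * of_real (1 - norm z)) \<le> M + norm p"
        using le Finite_Cartesian_Product.norm_nth_le[of "t *s V z" i]
          Finite_Cartesian_Product.norm_nth_le[of "t *s V z" j] by (simp_all add: Vi Vj)
      moreover have "norm (t * of_real (1 - norm z)) = norm t * (1 - norm z)"
        using t(2) unfolding norm_mult norm_of_real by simp
      ultimately show ?thesis by (simp add: R_def norm_mult algebra_simps)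
    qed
    \<comment> \<open>The chosen \<open>a\<close> and \<open>b\<close> may jump, so continuity of
      \<open>f\<close> is obtained from its graph: subsequential limits of \<open>a\<close> and
      \<open>b\<close> are again a similarity onto the limit section, and \<open>f\<close> does not
      depend on which similarity is used. Compactness of the circle turns a closed graph into
      continuity.\<close>
    have "closed ((\<lambda>z. (z, f z)) ` cball 0 1)"
      unfolding closed_sequential_limits
    proof (intro allI impI, elim conjE)
      fix x l assume x: "\<forall>n. x n \<in> (\<lambda>z. (z, f z)) ` cball 0 1" "x \<longlonglongrightarrow> l"
      define z where "z n = fst (x n)" for n
      have z: "z n \<in> cball 0 1" "x n = (z n, f (z n))" for n using x(1) by (auto simp: z_def image_iff dest!: spec[of _ n])
      have zl: "z \<longlonglongrightarrow> fst l"
        unfolding z_def[abs_def] by (rule tendsto_fst[OF x(2)])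
      have "f (z n) = snd (x n)" for n using z(2)[of n] by (metis snd_conv)
      then have fl: "(\<lambda>n. f (z n)) \<longlonglongrightarrow> snd l" using tendsto_snd[OF x(2)] by presburger
      have l1: "fst l \<in> cball 0 1" using closed_sequentially[OF closed_cball z(1) zl] .
      have bR: "norm (b (z n)) \<le> R" for n
        using R[OF _ z(1)] similar_via_iff[OF ab(2)] S0 by (metis add_0 mult_zero_right)
      have aR: "norm (a (z n)) \<le> 2 * R / norm \<eta>" for n
      proof -
        have "norm (a (z n) * \<eta> + b (z n)) \<le> R"
          using R[OF _ z(1)] similar_via_iff[OF ab(2)] \<eta>(2) by metis
        then have "norm (a (z n) * \<eta>) \<le> 2 * R"
          using norm_triangle_ineq4[of "a (z n) * \<eta> + b (z n)" "b (z n)"] bR[of n] by simp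
        then show ?thesis using \<eta>(1) by (simp add: norm_mult field_simps)
      qed
      have "bounded (range (\<lambda>n. (a (z n), b (z n))))"
      proof -
        have "norm (a (z n), b (z n)) \<le> 2 * R / norm \<eta> + R" for n
          using norm_Pair_le[of "a (z n)" "b (z n)"] aR[of n] bR[of n] by linarith
        then show ?thesis unfolding bounded_iff by blast
      qed
      then obtain ab' r where r: "strict_mono r" "((\<lambda>n. (a (z n), b (z n))) \<circ> r) \<longlonglongrightarrow> ab'"
        using bounded_imp_convergent_subsequence by blast
      define a' where "a' = fst ab'"
      define b' where "b' = snd ab'"
      have ar: "(\<lambda>n. a (z (r n))) \<longlonglongrightarrow> a'" and br: "(\<lambda>n. b (z (r n))) \<longlonglongrightarrow> b'"
        using tendsto_fst[OF r(2)] tendsto_snd[OF r(2)] by (simp_all add: o_def a'_def b'_def)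
      have zr: "(\<lambda>n. z (r n)) \<longlonglongrightarrow> fst l" and fr: "(\<lambda>n. f (z (r n))) \<longlonglongrightarrow> snd l"
        using LIMSEQ_subseq_LIMSEQ[OF zl r(1)] LIMSEQ_subseq_LIMSEQ[OF fl r(1)] by (simp_all add: o_def)
      have "(\<lambda>n. V (z (r n))) \<longlonglongrightarrow> V (fst l)"
        unfolding V_def by (intro tendsto_intros tendsto_smult_vec zr)
      from section_limit[OF body p this ar br ab(1) S(1) ab(2)]
      have a': "a' \<noteq> 0" "similar_via S a' b' (line_section K p (V (fst l)))" by blast+
      have "(\<lambda>n. f (z (r n))) \<longlonglongrightarrow> (a' / norm a') ^ k"
        unfolding f_def using a'(1) by (intro tendsto_intros ar) auto
      then have "snd l = (a' / norm a') ^ k" using fr LIMSEQ_unique by blast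
      then have "snd l = f (fst l)" using f[OF a'(2,1)] by simp
      then show "l \<in> (\<lambda>z. (z, f z)) ` cball 0 1"
        using l1 by (intro image_eqI[of _ _ "fst l"]) (auto simp: prod_eq_iff)
    qed
    then have "closedin (top_of_set (cball 0 1 \<times> sphere 0 1)) ((\<lambda>z. (z, f z)) ` cball 0 1)"
      using nf by (intro closed_subset) auto
    moreover have "f \<in> cball 0 1 \<rightarrow> sphere 0 1" using nf by auto
    ultimately have "continuous_on (cball 0 1) f"
      using continuous_closed_graph_eq[OF compact_sphere] by blast
    moreover have "f z \<noteq> 0" for z using nf[of z] by auto
    moreover have "f z * z ^ k = f 1" if z: "norm z = 1" for z
    proof -
      have "z \<noteq> 0" using z by auto
      have V1: "V z = z *s V 1" using z by (simp add: V_def)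
      \<comment> \<open>On the boundary circle all \<open>V z\<close> span the same line, merely
        reparametrised by \<open>z\<close>, so the similarity is explicit.\<close>
      have "similar_via S (inverse z) 0 (line_section K p (V z))"
      proof -
        have "(inverse z * t + 0) *s V z = t *s V 1" for t
        proof -
          have "(inverse z * t + 0) * z = t" using \<open>z \<noteq> 0\<close> by (simp add: field_simps)
          then show ?thesis by (simp only: V1 vector_smult_assoc)
        qed
        then show ?thesis
          unfolding similar_via_def S_def line_section_def mem_Collect_eq by presburger
      qed
      from f[OF this] have 1: "f z = inverse z ^ k" using \<open>z \<noteq> 0\<close> z by (simp add: norm_inverse)
      have "similar_via S 1 0 (line_section K p (V 1))"
        unfolding S_def by (simp add: similar_via_def)
      from f[OF this] have "f 1 = 1" by simp
      then show ?thesis using 1 \<open>z \<noteq> 0\<close> by (simp flip: power_mult_distrib)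
    qed
    ultimately show False using no_twisted_map_disc k(1) by blast
  qed
  then have "\<exists>b. similar_via S u b S" if "norm u = 1" for u
    using that unfolding G_def by (auto simp: set_eq_iff)
  then obtain c r where cr: "S = cball c r"
    using rotation_symmetric_imp_disc[OF S] S0 by blast
  show ?thesis
  proof (cases "\<exists>s t. s \<noteq> t \<and> s \<in> line_section K q w \<and> t \<in> line_section K q w")
    case True
    then obtain a b where "a \<noteq> 0" "similar_via S a b (line_section K q w)"
      using sim[OF V0 \<open>w \<noteq> 0\<close> \<eta>(1) \<eta>(2)[unfolded S_def] S0[unfolded S_def]] unfolding S_def by blast
    then show ?thesis using similar_via_cball unfolding cr by blast
  next
    case False
    then consider "line_section K q w = {}" | x where "line_section K q w = {x}" by blast
    then show ?thesis
    proof cases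
      case 1
      then have "line_section K q w = cball 0 (- 1)" by simp
      then show ?thesis by blast
    next
      case 2
      then have "line_section K q w = cball x 0" by simp
      then show ?thesis by blast
    qed
  qed
qed

section \<open>Ellipsoids are exactly the bodies with disc sections\<close>

text \<open>For a point \<open>p\<close> of \<open>K\<close> farthest from the origin,
  \<open>norm (x + p) \<le> norm p\<close> on the translate by \<open>- p\<close> expands to the
  enclosing-ball inequality with \<open>e = - p\<close>.\<close>

lemma disc_sections_imp_ellipsoid:
  fixes K :: "(complex ^ 'n) set"
  assumes body: "convex_body K" and disc: "\<And>p v. v \<noteq> 0 \<Longrightarrow> \<exists>c r. line_section K p v = cball c r"
  shows "complex_ellipsoid K"
proof -
  have K: "compact K" "K \<noteq> {}" using body interior_subset unfolding convex_body_def by auto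
  obtain p where p: "p \<in> K" "\<And>x. x \<in> K \<Longrightarrow> dist 0 x \<le> dist 0 p"
    using distance_attains_sup[OF K, of 0] by blast
  define K' where "K' = (\<lambda>x. x - p) ` K"
  have K': "x \<in> K' \<longleftrightarrow> x + p \<in> K" for x
    unfolding K'_def by (auto intro!: image_eqI[where x = "x + p"])
  interpret pinned_body K' "- p"
  proof
    have K'_eq: "K' = (+) (- p) ` K" by (simp add: K'_def)
    have "compact K'" unfolding K'_eq using K(1) by (rule compact_translation)
    moreover have "convex K'" unfolding K'_eq using body by (intro convex_translation) (simp add: convex_body_def)
    moreover have "interior K' = (+) (- p) ` interior K" unfolding K'_eq by (rule interior_translation)
    ultimately show "convex_body K'" using body unfolding convex_body_def by blast
    show "\<exists>c r. line_section K' q v = cball c r" if "v \<noteq> 0" for q v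
      using disc[OF that, of "q + p"] by (simp add: line_section_def K' algebra_simps)
    show "0 \<in> K'" using p(1) by (simp add: K')
    show "(norm x)\<^sup>2 \<le> 2 * (x \<bullet> - p)" if "x \<in> K'" for x
    proof -
      have "norm (x + p) \<le> norm p" using p(2)[of "x + p"] that by (simp add: K')
      then have "(norm (x + p))\<^sup>2 \<le> (norm p)\<^sup>2" by (simp add: power_mono)
      then show ?thesis
        by (simp add: power2_norm_eq_inner inner_add_left inner_add_right inner_commute)
    qed
  qed
  obtain A :: "complex ^ 'n ^ 'n" and b where A: "invertible A" "K' = (\<lambda>x. A *v x + b) ` cball 0 1"
    using ellipsoid unfolding complex_ellipsoid_def by blast
  have "K = (\<lambda>x. x + p) ` K'" by (simp add: K'_def image_image)
  also have "\<dots> = (\<lambda>x. A *v x + (b + p)) ` cball 0 1" by (simp add: A(2) image_image add.assoc)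
  finally show ?thesis unfolding complex_ellipsoid_def using A(1) by blast
qed

text \<open>Pulled back to the unit ball, the section is a sublevel set of the squared norm along a
  complex line, a quadratic in \<open>t\<close> with leading term
  \<open>m * (norm t)\<^sup>2\<close>; completing the square at \<open>c\<close> gives a disc,
  possibly empty.\<close>

lemma ellipsoid_sections_discs:
  fixes K :: "(complex ^ 'n) set"
  assumes "complex_ellipsoid K" "v \<noteq> 0"
  shows "\<exists>c r. line_section K p v = cball c r"
proof -
  obtain A :: "complex ^ 'n ^ 'n" and b where A: "invertible A" "K = (\<lambda>x. A *v x + b) ` cball 0 1"
    using assms(1) unfolding complex_ellipsoid_def by blast
  obtain B where B: "A ** B = mat 1" "B ** A = mat 1" using A(1) by (auto simp: invertible_def)
  have K: "x \<in> K \<longleftrightarrow> norm (B *v (x - b)) \<le> 1" for x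
  proof
    assume "x \<in> K"
    then show "norm (B *v (x - b)) \<le> 1" by (auto simp: A(2) matrix_vector_mul_assoc B)
  next
    assume "norm (B *v (x - b)) \<le> 1"
    moreover have "x = A *v (B *v (x - b)) + b" by (simp add: matrix_vector_mul_assoc B)
    ultimately show "x \<in> K" unfolding A(2) by (metis imageI mem_cball_0)
  qed
  define q where "q = B *v (p - b)"
  define u where "u = B *v v"
  have "u \<noteq> 0"
  proof
    assume "u = 0"
    then have "A *v u = 0" by simp
    then show False using assms(2) by (simp add: u_def matrix_vector_mul_assoc B)
  qed
  define m where "m = (norm u)\<^sup>2"
  have m: "m > 0" using \<open>u \<noteq> 0\<close> by (simp add: m_def)
  define c where "c = - hdot q u / of_real m"
  have sec: "t \<in> line_section K p v \<longleftrightarrow> (norm (q + t *s u))\<^sup>2 \<le> 1" for t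
  proof -
    have "B *v (p + t *s v - b) = q + t *s u"
      unfolding q_def u_def by (simp add: matrix_vector_mult_diff_distrib matrix_vector_right_distrib
          vector_scalar_commute algebra_simps)
    then show ?thesis by (simp add: line_section_def K abs_square_le_1)
  qed
  have sq: "(norm (q + t *s u))\<^sup>2 = m * (norm (t - c))\<^sup>2 + ((norm q)\<^sup>2 - m * (norm c)\<^sup>2)" for t
  proof -
    have "(norm (q + t *s u))\<^sup>2 = (norm q)\<^sup>2 + 2 * (q \<bullet> (t *s u)) + (norm (t *s u))\<^sup>2"
      by (simp add: power2_norm_eq_inner inner_add_left inner_add_right inner_commute)
    also have "q \<bullet> (t *s u) = Re (hdot (t *s u) q)" by (simp add: Re_hdot inner_commute)
    also have "hdot (t *s u) q = t * cnj (hdot q u)"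
      by (simp add: hdot_scale) (simp add: hdot_def mult.commute)
    also have "cnj (hdot q u) = - (of_real m * cnj c)" using m by (simp add: c_def)
    also have "(norm (t *s u))\<^sup>2 = m * (norm t)\<^sup>2" by (simp add: norm_smult_vec m_def power_mult_distrib)
    finally have 1: "(norm (q + t *s u))\<^sup>2 = (norm q)\<^sup>2 + 2 * Re (t * - (of_real m * cnj c)) + m * (norm t)\<^sup>2" .
    have 2: "(norm (t - c))\<^sup>2 = (norm t)\<^sup>2 - 2 * Re (t * cnj c) + (norm c)\<^sup>2"
      unfolding cmod_power2 by (simp add: power2_eq_square algebra_simps)
    show ?thesis unfolding 1 2 by (simp add: algebra_simps)
  qed
  define k where "k = (1 - ((norm q)\<^sup>2 - m * (norm c)\<^sup>2)) / m"
  have key: "t \<in> line_section K p v \<longleftrightarrow> (norm (t - c))\<^sup>2 \<le> k" for t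
  proof -
    have "(norm (t - c))\<^sup>2 \<le> k \<longleftrightarrow> (norm (t - c))\<^sup>2 * m \<le> 1 - ((norm q)\<^sup>2 - m * (norm c)\<^sup>2)"
      unfolding k_def using m by (rule pos_le_divide_eq)
    then show ?thesis unfolding sec sq by (simp add: algebra_simps)
  qed
  show ?thesis
  proof (cases "k < 0")
    case True
    then have "\<not> (norm (t - c))\<^sup>2 \<le> k" for t using zero_le_power2[of "norm (t - c)"] by linarith
    then have "line_section K p v = cball 0 (- 1)" using key by auto
    then show ?thesis by blast
  next
    case False
    have "(norm (t - c))\<^sup>2 \<le> k \<longleftrightarrow> norm (t - c) \<le> sqrt k" for t
      by (metis abs_norm_cancel real_sqrt_abs real_sqrt_le_iff)
    then have "line_section K p v = cball c (sqrt k)"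
      using key by (simp add: set_eq_iff dist_norm norm_minus_commute)
    then show ?thesis by blast
  qed
qed

lemma discs_similar:
  assumes "line_section K p v = cball c r" "s \<in> line_section K p v" "t \<in> line_section K p v" "s \<noteq> t"
    and "line_section K q w = cball c' r'" "s' \<in> line_section K q w" "t' \<in> line_section K q w" "s' \<noteq> t'"
  shows "\<exists>a b. a \<noteq> 0 \<and> similar_via (line_section K p v) a b (line_section K q w)"
proof -
  have pos: "0 < r" if "x \<in> cball c r" "y \<in> cball c r" "x \<noteq> y" for x y c :: complex and r
  proof (rule ccontr)
    assume "\<not> 0 < r"
    then have "dist c x \<le> 0" "dist c y \<le> 0" using that(1,2) unfolding mem_cball by linarith+
    then show False using that(3) by simp
  qed
  have r: "0 < r" "0 < r'" using pos assms by metis+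
  define a where "a = complex_of_real (r' / r)"
  have "a \<noteq> 0" and na: "norm a = r' / r" using r by (simp_all add: a_def norm_divide)
  moreover have "similar_via (line_section K p v) a (c' - a * c) (line_section K q w)"
    unfolding similar_via_def assms(1,5)
  proof
    fix t
    have "c' - (a * t + (c' - a * c)) = a * (c - t)" by (simp add: algebra_simps)
    then have "dist c' (a * t + (c' - a * c)) = r' / r * dist c t"
      by (simp only: dist_norm norm_mult na)
    moreover have "r' / r * dist c t \<le> r' \<longleftrightarrow> dist c t \<le> r"
      using r by (simp add: field_simps)
    ultimately show "t \<in> cball c r \<longleftrightarrow> a * t + (c' - a * c) \<in> cball c' r'" by simp
  qed
  ultimately show ?thesis by blast
qed

theorem theorem4p4:
  fixes K :: "(complex ^ 'n) set"
  assumes "CARD('n) \<ge> 2"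
    and "convex_body K"
  shows "complex_ellipsoid K \<longleftrightarrow>
    (\<forall>L1 L2. complex_affine_line L1 \<and> complex_affine_line L2 \<and>
        nontrivial_section K L1 \<and> nontrivial_section K L2 \<longrightarrow>
        (\<exists>\<phi>. bij_betw \<phi> L1 L2 \<and> complex_affine_on L1 \<phi> \<and> \<phi> ` (L1 \<inter> K) = L2 \<inter> K))"
proof
  assume E: "complex_ellipsoid K"
  show "\<forall>L1 L2. complex_affine_line L1 \<and> complex_affine_line L2 \<and>
        nontrivial_section K L1 \<and> nontrivial_section K L2 \<longrightarrow>
        (\<exists>\<phi>. bij_betw \<phi> L1 L2 \<and> complex_affine_on L1 \<phi> \<and> \<phi> ` (L1 \<inter> K) = L2 \<inter> K)"
  proof (intro allI impI, elim conjE)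
    fix L1 L2
    assume "complex_affine_line L1" "complex_affine_line L2"
      and nt: "nontrivial_section K L1" "nontrivial_section K L2"
    then obtain p v q w where v: "v \<noteq> 0" "L1 = {p + t *s v | t. True}"
      and w: "w \<noteq> 0" "L2 = {q + t *s w | t. True}"
      unfolding complex_affine_line_def by blast
    obtain a b where "a \<noteq> 0" "similar_via (line_section K p v) a b (line_section K q w)"
      using discs_similar ellipsoid_sections_discs[OF E] nt nontrivial_section_line v w by metis
    then show "\<exists>\<phi>. bij_betw \<phi> L1 L2 \<and> complex_affine_on L1 \<phi> \<and> \<phi> ` (L1 \<inter> K) = L2 \<inter> K"
      unfolding v(2) w(2) by (rule similar_imp_affine_bijection[OF v(1) w(1)])
  qed
next
  assume R: "\<forall>L1 L2. complex_affine_line L1 \<and> complex_affine_line L2 \<and>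
        nontrivial_section K L1 \<and> nontrivial_section K L2 \<longrightarrow>
        (\<exists>\<phi>. bij_betw \<phi> L1 L2 \<and> complex_affine_on L1 \<phi> \<and> \<phi> ` (L1 \<inter> K) = L2 \<inter> K)"
  have sim: "\<exists>a b. a \<noteq> 0 \<and> similar_via (line_section K p v) a b (line_section K q w)"
    if "v \<noteq> 0" "w \<noteq> 0" "s \<noteq> t" "s \<in> line_section K p v" "t \<in> line_section K p v"
      "s' \<noteq> t'" "s' \<in> line_section K q w" "t' \<in> line_section K q w" for p v q w s t s' t'
  proof -
    have "nontrivial_section K {p + t *s v | t. True}" "nontrivial_section K {q + t *s w | t. True}"
      using that nontrivial_section_line by blast+
    moreover have "complex_affine_line {p + t *s v | t. True}" "complex_affine_line {q + t *s w | t. True}"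
      using that unfolding complex_affine_line_def by blast+
    ultimately obtain \<phi> where "bij_betw \<phi> {p + t *s v | t. True} {q + t *s w | t. True}"
      "complex_affine_on {p + t *s v | t. True} \<phi>"
      "\<phi> ` ({p + t *s v | t. True} \<inter> K) = {q + t *s w | t. True} \<inter> K"
      using R by blast
    then show ?thesis by (rule affine_bijection_imp_similar[OF that(1,2)])
  qed
  show "complex_ellipsoid K"
  proof (rule disc_sections_imp_ellipsoid[OF assms(2)])
    show "\<exists>c r. line_section K p v = cball c r" if v: "v \<noteq> 0" for p v
      by (rule sections_similar_imp_discs[OF assms _ v]) (rule sim, assumption+)
  qed
qed

end
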